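(* Let $X$ be a stable set of functions on $\Omega$, $\mathcal{X}$ a stable ring on $X$ and $\mu:\mathcal{X}\to\bar L^0_+$ a stable pre-measure. Then there exists a stable measure $\nu:\Sigma(\mathcal{X})\to\bar L^0_+$ which coincides with $\mu$ on $\mathcal{X}$.
   Context: $(\Omega,\mathscr{F},\mathbb{P})$ is a complete probability space; $A,B\in\mathscr{F}$ are identified if $\mathbb{P}(A\Delta B)=0$, and inclusions and (in)equalities between (extended) random variables are understood a.s. $\bar L^0_+$ is the set of all measurable functions $\Omega\to[0,\infty]$ (mod a.s. equality). A partition (of $\Omega$) is a countable pairwise disjoint family $(A_k)$ in $\mathscr{F}$ with $\bigcup_k A_k=\Omega$. For a function $x$ on $\Omega$ and $A\in\mathscr{F}$, $x|A$ is the restriction of $x$ to $A$; $x|A$ and $y|B$ are identified if $\mathbb{P}(A\Delta B)=0$ and $x=y$ a.e. on $A\cap B$. For a sequence of functions $(x_k)$ and a partition $(A_k)$, $\sum x_k|A_k$ is the function equal to $x_k$ on $A_k$ for each $k$ (so $r|A+0|A^c$ equals $r$ on $A$ and $0$ on $A^c$). For a set $X$ of functions on $\Omega$, $X|A:=\{x|A: x\in X\}$, $(X|A)|B:=X|A\cap B$, $X|\emptyset=\{\ast\}$ is a singleton, $X|\Omega=X$. A set $X$ of functions on $\Omega$ with values in a fixed set is stable if $X\neq\emptyset$ and $\sum x_k|A_k\in X$ for all partitions $(A_k)$ and sequences $(x_k)$ in $X$. For a stable set $X$, $\mathcal{P}(X)$ is the collection of all conditional subsets $V|A$, with $V\subseteq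 X$ stable and $A\in\mathscr{F}$. For stable $V_k\subseteq X$ and a partition $(A_k)$, $\sum V_k|A_k:=\{\sum x_k|A_k: x_k\in V_k \text{ for all } k\}$, and concatenations in $\mathcal{P}(X)$ are defined by $\sum (V_k|B_k)|A_k:=(\sum V_k|A_k)|\bigcup_k(A_k\cap B_k)$. A subset of $\mathcal{P}(X)$ is a stable collection if it is nonempty and closed under such countable concatenations. Conditional inclusion: $V|A\sqsubseteq W|B$ iff $A\subseteq B$ and $V|A\subseteq W|A$. $(\mathcal{P}(X),\sqsubseteq)$ is a complete Boolean algebra with greatest element $X$ and least element $\{\ast\}=X|\emptyset$; $\sqcup,\sqcap,{}^\sqsubset$ denote its supremum, infimum and complement. $V|A$ and $W|B$ are disjoint if $V|A\sqcap W|B=\{\ast\}$. A stable collection $\mathcal{X}\subseteq\mathcal{P}(X)$ is a stable ring if $V|A\sqcap(W|B)^\sqsubset$ and $V|A\sqcup W|B$ are in $\mathcal{X}$ for all $V|A,W|B\in\mathcal{X}$; it is a stable $\sigma$-algebra if $X\in\mathcal{X}$, it is closed under ${}^\sqsubset$, and $\sqcup_k(V_k|A_k)\in\mathcal{X}$ for all sequences in $\mathcal{X}$. $\Sigma(\mathcal{X})$ is the smallest stable $\sigma$-algebra containing $\mathcal{X}$. A function $\mu:\mathcal{X}\to\bar L^0_+$ on a stable collection is stable if $\mu(\sum(V_k|B_k)|A_k)=\sum\mu(V_k|B_k)|A_k$ for all sequences $(V_k|B_k)$ in $\mathcal{X}$ and partitions $(A_k)$. A stable pre-measure on a stable ring $\mathcal{X}$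 is a stable function $\mu:\mathcal{X}\to\bar L^0_+$ such that (M1) $\mu(V|A)=\mu(V|A)|A+0|A^c$ for all $V|A\in\mathcal{X}$; (M2) $\mu(\sqcup_k(V_k|A_k))=\sum_{k\ge1}\mu(V_k|A_k)$ (series pointwise a.s.) for all sequences $(V_k|A_k)$ of pairwise disjoint elements of $\mathcal{X}$ with $\sqcup_k(V_k|A_k)\in\mathcal{X}$. A stable measure is a stable pre-measure whose domain is a stable $\sigma$-algebra. *)

theory Defs
  imports "HOL-Probability.Probability" "HOL-Algebra.Lattice"
begin

text \<open>
  The base space is \<open>M\<close>, with \<open>\<Omega> = space M\<close>. Functions on \<open>\<Omega>\<close> are represented by total functions;
  everything below depends on them only up to equality almost everywhere, so that their
  values outside \<open>\<Omega>\<close> are irrelevant.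
\<close>

definition is_partition :: "'w measure \<Rightarrow> (nat \<Rightarrow> 'w set) \<Rightarrow> bool" where
  "is_partition M A \<longleftrightarrow> range A \<subseteq> sets M \<and> disjoint_family A \<and> (\<Union>k. A k) = space M"

definition concat_fun :: "(nat \<Rightarrow> 'w \<Rightarrow> 'b) \<Rightarrow> (nat \<Rightarrow> 'w set) \<Rightarrow> 'w \<Rightarrow> 'b" where
  "concat_fun x A \<omega> = x (THE k. \<omega> \<in> A k) \<omega>"

definition ae_mem :: "'w measure \<Rightarrow> ('w \<Rightarrow> 'e) \<Rightarrow> ('w \<Rightarrow> 'e) set \<Rightarrow> bool" where
  "ae_mem M x X \<longleftrightarrow> (\<exists>y\<in>X. AE \<omega> in M. x \<omega> = y \<omega>)"

definition stable_set :: "'w measure \<Rightarrow> ('w \<Rightarrow> 'e) set \<Rightarrow> bool" where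
  "stable_set M X \<longleftrightarrow> X \<noteq> {} \<and>
     (\<forall>A x. is_partition M A \<longrightarrow> (\<forall>k. x k \<in> X) \<longrightarrow> ae_mem M (concat_fun x A) X)"

definition stable_subsets :: "'w measure \<Rightarrow> ('w \<Rightarrow> 'e) set \<Rightarrow> ('w \<Rightarrow> 'e) set set" where
  "stable_subsets M X = {V. stable_set M V \<and> (\<forall>x\<in>V. ae_mem M x X)}"

definition concat_set ::
    "(nat \<Rightarrow> ('w \<Rightarrow> 'e) set) \<Rightarrow> (nat \<Rightarrow> 'w set) \<Rightarrow> ('w \<Rightarrow> 'e) set" where
  "concat_set V A = {concat_fun x A | x. \<forall>k. x k \<in> V k}"


text \<open>
  The restriction \<open>x|A\<close> is the equivalence class of \<open>(x, A)\<close> under the identification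
  of \<open>x|A\<close> with \<open>y|B\<close>. In particular all restrictions to null sets coincide, and
  \<open>V|A\<close> determines \<open>A\<close> up to a null set if \<open>V\<close> is nonempty.
\<close>

type_synonym ('w, 'e) cond_elem = "(('w \<Rightarrow> 'e) \<times> 'w set) set"
type_synonym ('w, 'e) cond_set = "('w, 'e) cond_elem set"

definition restrict_fun :: "'w measure \<Rightarrow> ('w \<Rightarrow> 'e) \<Rightarrow> 'w set \<Rightarrow> ('w, 'e) cond_elem" where
  "restrict_fun M x A =
     {(y, B). B \<in> sets M \<and> sym_diff A B \<in> null_sets M \<and> (AE \<omega> in M. \<omega> \<in> A \<inter> B \<longrightarrow> x \<omega> = y \<omega>)}"

definition restrict_set :: "'w measure \<Rightarrow> ('w \<Rightarrow> 'e) set \<Rightarrow> 'w set \<Rightarrow> ('w, 'e) cond_set" where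
  "restrict_set M V A = (\<lambda>x. restrict_fun M x A) ` V"

definition cond_sets :: "'w measure \<Rightarrow> ('w \<Rightarrow> 'e) set \<Rightarrow> ('w, 'e) cond_set set" where
  "cond_sets M X = {restrict_set M V A | V A. V \<in> stable_subsets M X \<and> A \<in> sets M}"

definition cond_le ::
    "'w measure \<Rightarrow> ('w \<Rightarrow> 'e) set \<Rightarrow> ('w, 'e) cond_set \<Rightarrow> ('w, 'e) cond_set \<Rightarrow> bool" where
  "cond_le M X C D \<longleftrightarrow>
     (\<exists>V\<in>stable_subsets M X. \<exists>W\<in>stable_subsets M X. \<exists>A\<in>sets M. \<exists>B\<in>sets M.
        C = restrict_set M V A \<and> D = restrict_set M W B \<and>
        A - B \<in> null_sets M \<and> restrict_set M V A \<subseteq> restrict_set M W A)"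

definition cond_order :: "'w measure \<Rightarrow> ('w \<Rightarrow> 'e) set \<Rightarrow> ('w, 'e) cond_set gorder" where
  "cond_order M X = \<lparr>carrier = cond_sets M X, eq = (=), le = cond_le M X\<rparr>"

definition cond_Sup ::
    "'w measure \<Rightarrow> ('w \<Rightarrow> 'e) set \<Rightarrow> ('w, 'e) cond_set set \<Rightarrow> ('w, 'e) cond_set" where
  "cond_Sup M X S = \<Squnion>\<^bsub>cond_order M X\<^esub>S"

definition cond_sup ::
    "'w measure \<Rightarrow> ('w \<Rightarrow> 'e) set \<Rightarrow> ('w, 'e) cond_set \<Rightarrow> ('w, 'e) cond_set \<Rightarrow> ('w, 'e) cond_set" where
  "cond_sup M X C D = C \<squnion>\<^bsub>cond_order M X\<^esub> D"

definition cond_inf ::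
    "'w measure \<Rightarrow> ('w \<Rightarrow> 'e) set \<Rightarrow> ('w, 'e) cond_set \<Rightarrow> ('w, 'e) cond_set \<Rightarrow> ('w, 'e) cond_set" where
  "cond_inf M X C D = C \<sqinter>\<^bsub>cond_order M X\<^esub> D"

definition cond_top :: "'w measure \<Rightarrow> ('w \<Rightarrow> 'e) set \<Rightarrow> ('w, 'e) cond_set" where
  "cond_top M X = restrict_set M X (space M)"

definition cond_bot :: "'w measure \<Rightarrow> ('w \<Rightarrow> 'e) set \<Rightarrow> ('w, 'e) cond_set" where
  "cond_bot M X = restrict_set M X {}"

text \<open>
  For a stable set \<open>X\<close> over a probability space, \<open>cond_order M X\<close> is a complete Boolean algebra, so
  that the suprema and infima above exist and the complement exists and is unique.
\<close>

definition cond_compl ::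
    "'w measure \<Rightarrow> ('w \<Rightarrow> 'e) set \<Rightarrow> ('w, 'e) cond_set \<Rightarrow> ('w, 'e) cond_set" where
  "cond_compl M X C =
     (THE D. D \<in> cond_sets M X \<and> cond_sup M X C D = cond_top M X \<and> cond_inf M X C D = cond_bot M X)"


text \<open>
  Concatenations in \<open>cond_sets M X\<close> are defined through representatives
  \<open>V k\<close>, \<open>B k\<close>. The result depends only on the conditional sets \<open>V k|B k\<close>, hence it makes no
  difference that the definitions below quantify over all representatives.
\<close>

definition cond_concat ::
    "'w measure \<Rightarrow> (nat \<Rightarrow> ('w \<Rightarrow> 'e) set) \<Rightarrow> (nat \<Rightarrow> 'w set) \<Rightarrow> (nat \<Rightarrow> 'w set) \<Rightarrow> ('w, 'e) cond_set" where
  "cond_concat M V B A = restrict_set M (concat_set V A) (\<Union>k. A k \<inter> B k)"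

definition stable_collection ::
    "'w measure \<Rightarrow> ('w \<Rightarrow> 'e) set \<Rightarrow> ('w, 'e) cond_set set \<Rightarrow> bool" where
  "stable_collection M X \<X> \<longleftrightarrow> \<X> \<subseteq> cond_sets M X \<and> \<X> \<noteq> {} \<and>
     (\<forall>V B A. (\<forall>k. V k \<in> stable_subsets M X \<and> B k \<in> sets M \<and> restrict_set M (V k) (B k) \<in> \<X>) \<longrightarrow>
        is_partition M A \<longrightarrow> cond_concat M V B A \<in> \<X>)"

definition stable_ring ::
    "'w measure \<Rightarrow> ('w \<Rightarrow> 'e) set \<Rightarrow> ('w, 'e) cond_set set \<Rightarrow> bool" where
  "stable_ring M X \<X> \<longleftrightarrow> stable_collection M X \<X> \<and>
     (\<forall>C\<in>\<X>. \<forall>D\<in>\<X>. cond_inf M X C (cond_compl M X D) \<in> \<X> \<and> cond_sup M X C D \<in> \<X>)"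

definition stable_sigma_algebra ::
    "'w measure \<Rightarrow> ('w \<Rightarrow> 'e) set \<Rightarrow> ('w, 'e) cond_set set \<Rightarrow> bool" where
  "stable_sigma_algebra M X \<X> \<longleftrightarrow> stable_collection M X \<X> \<and>
     cond_top M X \<in> \<X> \<and>
     (\<forall>C\<in>\<X>. cond_compl M X C \<in> \<X>) \<and>
     (\<forall>C :: nat \<Rightarrow> ('w, 'e) cond_set. range C \<subseteq> \<X> \<longrightarrow> cond_Sup M X (range C) \<in> \<X>)"

definition gen_stable_sigma_algebra ::
    "'w measure \<Rightarrow> ('w \<Rightarrow> 'e) set \<Rightarrow> ('w, 'e) cond_set set \<Rightarrow> ('w, 'e) cond_set set" where
  "gen_stable_sigma_algebra M X \<X> = \<Inter>{\<S>. stable_sigma_algebra M X \<S> \<and> \<X> \<subseteq> \<S>}"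


text \<open>
  A map into the space of a.s. classes of measurable functions \<open>\<Omega> \<rightarrow> [0,\<infinity>]\<close> is represented by a
  choice of representatives, all equalities between its values being a.s. equalities.
  Its values outside of the collection \<open>\<X>\<close> are irrelevant.
\<close>

definition stable_function ::
    "'w measure \<Rightarrow> ('w \<Rightarrow> 'e) set \<Rightarrow> ('w, 'e) cond_set set \<Rightarrow> (('w, 'e) cond_set \<Rightarrow> 'w \<Rightarrow> ennreal) \<Rightarrow> bool" where
  "stable_function M X \<X> \<mu> \<longleftrightarrow> stable_collection M X \<X> \<and>
     (\<forall>C\<in>\<X>. \<mu> C \<in> borel_measurable M) \<and>
     (\<forall>V B A. (\<forall>k. V k \<in> stable_subsets M X \<and> B k \<in> sets M \<and> restrict_set M (V k) (B k) \<in> \<X>) \<longrightarrow>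
        is_partition M A \<longrightarrow>
        (AE \<omega> in M. \<mu> (cond_concat M V B A) \<omega> = concat_fun (\<lambda>k. \<mu> (restrict_set M (V k) (B k))) A \<omega>))"

definition stable_premeasure ::
    "'w measure \<Rightarrow> ('w \<Rightarrow> 'e) set \<Rightarrow> ('w, 'e) cond_set set \<Rightarrow> (('w, 'e) cond_set \<Rightarrow> 'w \<Rightarrow> ennreal) \<Rightarrow> bool" where
  "stable_premeasure M X \<X> \<mu> \<longleftrightarrow> stable_ring M X \<X> \<and> stable_function M X \<X> \<mu> \<and>
     (\<forall>V\<in>stable_subsets M X. \<forall>A\<in>sets M. restrict_set M V A \<in> \<X> \<longrightarrow>
        (AE \<omega> in M. \<mu> (restrict_set M V A) \<omega> = (if \<omega> \<in> A then \<mu> (restrict_set M V A) \<omega> else 0))) \<and>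
     (\<forall>C :: nat \<Rightarrow> ('w, 'e) cond_set. range C \<subseteq> \<X> \<longrightarrow>
        (\<forall>i j. i \<noteq> j \<longrightarrow> cond_inf M X (C i) (C j) = cond_bot M X) \<longrightarrow>
        cond_Sup M X (range C) \<in> \<X> \<longrightarrow>
        (AE \<omega> in M. \<mu> (cond_Sup M X (range C)) \<omega> = (\<Sum>k. \<mu> (C k) \<omega>)))"

definition stable_measure ::
    "'w measure \<Rightarrow> ('w \<Rightarrow> 'e) set \<Rightarrow> ('w, 'e) cond_set set \<Rightarrow> (('w, 'e) cond_set \<Rightarrow> 'w \<Rightarrow> ennreal) \<Rightarrow> bool" where
  "stable_measure M X \<X> \<mu> \<longleftrightarrow> stable_premeasure M X \<X> \<mu> \<and> stable_sigma_algebra M X \<X>"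

end

theory Submission
  imports Defs
begin

text \<open>
  The conditional subsets of \<open>X\<close> form a complete Boolean algebra that is in general not an algebra
  of sets, so the classical extension theorem does not apply to it directly, and the values of
  \<open>\<mu>\<close> are functions rather than numbers. Both obstacles are removed by representation.

  \<^emph>\<open>From conditional sets to sets.\<close> A conditional set \<open>C\<close> is determined by the events
  ``\<open>x\<close> belongs to \<open>C\<close>'', that is, by the largest event \<open>S\<^sub>x\<close> on which \<open>x\<close> agrees with a member of
  \<open>C\<close>; it exists because stability makes the collection of such events closed under countable
  unions (\<open>exhaustion\<close>, \<open>locally_in_UN\<close>). The events \<open>S\<^sub>x\<close> are the sections of a set
  \<open>S \<subseteq> X \<times> \<Omega>\<close>, here called a \<^emph>\<open>region\<close>. They satisfy one compatibility condition: wherever \<open>x\<close>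
  and \<open>y\<close> coincide, \<open>S\<^sub>x\<close> and \<open>S\<^sub>y\<close> coincide. Conversely, every region comes from a conditional set
  (\<open>ex_region\<close>, \<open>ex_cond_set\<close>). Regions form an honest \<open>\<sigma>\<close>-algebra of sets, the conditional order
  becomes inclusion of all sections up to null sets (\<open>cond_le_iff_region_le\<close>), and therefore
  countable suprema, infima, complements and concatenations become unions, intersections,
  complements and unions of slices (\<open>cond_Sup_cond_of\<close>, \<open>cond_inf_cond_of\<close>,
  \<open>cond_compl_cond_of\<close>, \<open>cond_concat_eq\<close>). The conditional sets are thus the quotient of a
  \<open>\<sigma>\<close>-algebra of sets by a \<open>\<sigma>\<close>-ideal, as in the Loomis--Sikorski theorem.

  \<^emph>\<open>From functions to numbers.\<close> On the ring \<open>R\<close> of regions that represent elements of \<open>\<X>\<close>, the mean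
  mass \<open>S \<mapsto> \<integral> \<mu>(S) dP\<close> is an ordinary countably additive set function. Its outer measure is a measure
  on the Caratheodory-measurable sets. Besides \<open>R\<close>, these contain all cylinders \<open>X \<times> A\<close>, because \<open>R\<close> is
  closed under slicing by cylinders (\<open>lambda_system_of_slices\<close>). Hence the measurable regions represent
  a stable \<open>\<sigma>\<close>-algebra \<open>\<S>\<close> that contains \<open>\<X>\<close>, and so contains the generated one.

  \<^emph>\<open>Back to functions.\<close> For a measurable region \<open>S\<close>, the mass of \<open>S \<inter> (X \<times> A)\<close> as a function of the
  event \<open>A\<close> is a measure on \<open>\<Omega>\<close> that vanishes on null sets, and \<open>\<nu>(S)\<close> is its Radon--Nikodym
  density, which exists for infinite measures as well. A function with values in \<open>[0, \<infinity>]\<close> is determined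
  almost surely by its integrals over all events, so every law of a stable measure for \<open>\<nu>\<close>, as well as
  \<open>\<nu> = \<mu>\<close> on \<open>\<X>\<close>, follows by integrating and using that the mass is a measure.
\<close>

section \<open>Gluing and exhaustion\<close>

text \<open>
  A countable union of members whose probabilities approach the supremum of all probabilities
  attains it; any member not almost contained in this union would push the probability higher.
  This is how essential suprema of events enter the proof.
\<close>

lemma (in prob_space) exhaustion:
  assumes sub: "\<B> \<subseteq> sets M" and ne: "\<B> \<noteq> {}"
    and UN: "\<And>B :: nat \<Rightarrow> 'a set. range B \<subseteq> \<B> \<Longrightarrow> (\<Union>n. B n) \<in> \<B>"
  obtains D where "D \<in> \<B>" "\<And>B. B \<in> \<B> \<Longrightarrow> AE \<omega> in M. \<omega> \<in> B \<longrightarrow> \<omega> \<in> D"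
proof -
  define s where "s = Sup (prob ` \<B>)"
  have bdd: "bdd_above (prob ` \<B>)"
    by (rule bdd_aboveI[of _ 1]) auto
  have "\<exists>B\<in>\<B>. s - 1 / Suc n < prob B" for n
    using less_cSup_iff[OF _ bdd, of "s - 1 / Suc n"] ne by (auto simp: s_def)
  then obtain B where B: "\<And>n. B n \<in> \<B>" "\<And>n. s - 1 / Suc n < prob (B n)"
    by metis
  define D where "D = (\<Union>n. B n)"
  have D: "D \<in> \<B>"
    unfolding D_def using B(1) by (intro UN) auto
  have "s - 1 / Suc n \<le> prob D" for n
    using B sub D by (intro less_imp_le[OF less_le_trans[OF B(2)]] finite_measure_mono) (auto simp: D_def)
  then have "s \<le> prob D + e" if "0 < e" for e
    using that nat_approx_posE[of e] by (smt (verit, best))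
  then have sD: "s \<le> prob D"
    by (rule field_le_epsilon)
  show thesis
  proof (rule that[OF D])
    fix C assume C: "C \<in> \<B>"
    \<comment> \<open>a binary union, written as a countable one since that is what the hypothesis provides\<close>
    have "(\<Union>n::nat. if n = 0 then C else D) \<in> \<B>"
      using C D by (intro UN) auto
    moreover have "(\<Union>n::nat. if n = 0 then C else D) = C \<union> D"
      by (auto split: if_splits)
    ultimately have CD: "C \<union> D \<in> \<B>" by simp
    have "prob (C \<union> D) \<le> s"
      unfolding s_def by (rule cSup_upper[OF _ bdd]) (use CD in auto)
    moreover have "prob (C \<union> D) = prob D + prob (C - D)"
      using C D sub by (subst finite_measure_Union[symmetric]) (auto intro!: arg_cong[where f=prob])
    ultimately have "prob (C - D) = 0"
      using sD measure_nonneg[of M "C - D"] by linarith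
    then have "C - D \<in> null_sets M"
      using C D sub by (auto simp: emeasure_eq_measure null_sets_def)
    from AE_not_in[OF this] show "AE \<omega> in M. \<omega> \<in> C \<longrightarrow> \<omega> \<in> D"
      by eventually_elim auto
  qed
qed

lemma concat_fun_eq: "is_partition M A \<Longrightarrow> \<omega> \<in> A k \<Longrightarrow> concat_fun x A \<omega> = x k \<omega>"
proof -
  assume A: "is_partition M A" "\<omega> \<in> A k"
  then have "(THE k. \<omega> \<in> A k) = k"
    by (intro the_equality) (auto simp: is_partition_def disjoint_family_on_def)
  then show ?thesis
    by (simp add: concat_fun_def)
qed

lemma partition_cover: "is_partition M A \<Longrightarrow> \<omega> \<in> space M \<Longrightarrow> \<exists>k. \<omega> \<in> A k"
  by (auto simp: is_partition_def)

lemma partition_unique: "is_partition M A \<Longrightarrow> \<omega> \<in> A i \<Longrightarrow> \<omega> \<in> A j \<Longrightarrow> i = j"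
  by (auto simp: is_partition_def disjoint_family_on_def)

lemma partition_sets: "is_partition M A \<Longrightarrow> A k \<in> sets M"
  by (auto simp: is_partition_def)

lemma AE_partitionI:
  assumes "is_partition M A" "\<And>k. AE \<omega> in M. \<omega> \<in> A k \<longrightarrow> P \<omega>"
  shows "AE \<omega> in M. P \<omega>"
proof -
  have "AE \<omega> in M. \<forall>k. \<omega> \<in> A k \<longrightarrow> P \<omega>"
    unfolding AE_all_countable using assms(2) by blast
  with AE_space show ?thesis
    by eventually_elim (use partition_cover[OF assms(1)] in blast)
qed

lemma binary_partition:
  assumes "A \<in> sets M"
  shows "is_partition M (\<lambda>k. if k = 0 then A else if k = 1 then space M - A else {})"
proof -
  have "(\<Union>k::nat. if k = 0 then A else if k = 1 then space M - A else {}) = space M" (is "?U = _")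
  proof
    show "space M \<subseteq> ?U"
    proof
      fix \<omega> assume "\<omega> \<in> space M"
      then show "\<omega> \<in> ?U"
        by (cases "\<omega> \<in> A") (auto intro: UN_I[of 0] UN_I[of 1])
    qed
  next
    show "?U \<subseteq> space M"
      using sets.sets_into_space[OF assms] by (auto split: if_splits)
  qed
  then show ?thesis
    using assms by (auto simp: is_partition_def disjoint_family_on_def split: if_splits)
qed

lemma partition_of_sequence:
  fixes B :: "nat \<Rightarrow> 'a set"
  assumes "range B \<subseteq> sets M"
  obtains A where "is_partition M A" "\<And>n. A (Suc n) \<subseteq> B n" "(\<Union>n. A (Suc n)) = (\<Union>n. B n)"
proof -
  define A where "A = case_nat (space M - (\<Union>n. B n)) (disjointed B)"
  have "(\<Union>n. A n) = A 0 \<union> (\<Union>n. A (Suc n))"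
    by (subst UNIV_nat_eq) simp
  also have "\<dots> = space M"
  proof -
    have "(\<Union>n. B n) \<subseteq> space M"
      using sets.sets_into_space assms by blast
    then show ?thesis
      by (auto simp: A_def UN_disjointed_eq)
  qed
  finally have "(\<Union>n. A n) = space M" .
  moreover have "disjoint_family A"
  proof -
    have *: "disjointed B n \<subseteq> (\<Union>n. B n)" for n
      using disjointed_subset[of B n] by auto
    have "disjointed B m \<inter> disjointed B n = {}" if "m \<noteq> n" for m n
      using disjoint_family_disjointed[of B] that by (auto simp: disjoint_family_on_def)
    then have "A m \<inter> A n = {}" if "m \<noteq> n" for m n
      using that * [of "m - 1"] * [of "n - 1"] by (cases m; cases n) (auto simp: A_def)
    then show ?thesis
      by (auto simp: disjoint_family_on_def)
  qed
  moreover have "range A \<subseteq> sets M"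
  proof -
    have "range (disjointed B) \<subseteq> sets M"
      using assms by (rule sets.range_disjointed_sets)
    then show ?thesis
      using assms by (auto simp: A_def split: nat.splits)
  qed
  ultimately have "is_partition M A"
    by (simp add: is_partition_def)
  then show thesis
    by (rule that) (simp_all add: A_def disjointed_subset UN_disjointed_eq)
qed

section \<open>Restrictions and their identification\<close>

text \<open>
  Almost-everywhere statements compose better than null sets, so the identifications in the
  definition of \<open>restrict_fun\<close> and in the conditional inclusion are restated in that form.
\<close>

lemma sym_diff_null_iff:
  assumes "A \<in> sets M" "B \<in> sets M"
  shows "sym_diff A B \<in> null_sets M \<longleftrightarrow> (AE \<omega> in M. \<omega> \<in> A \<longleftrightarrow> \<omega> \<in> B)"
proof -
  have "{\<omega> \<in> space M. \<not> (\<omega> \<in> A \<longleftrightarrow> \<omega> \<in> B)} = sym_diff A B"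
    using assms[THEN sets.sets_into_space] by auto
  then show ?thesis
    using assms by (subst AE_iff_null) auto
qed

lemma Diff_null_iff:
  assumes "A \<in> sets M" "B \<in> sets M"
  shows "A - B \<in> null_sets M \<longleftrightarrow> (AE \<omega> in M. \<omega> \<in> A \<longrightarrow> \<omega> \<in> B)"
proof -
  have "{\<omega> \<in> space M. \<not> (\<omega> \<in> A \<longrightarrow> \<omega> \<in> B)} = A - B"
    using assms[THEN sets.sets_into_space] by auto
  then show ?thesis
    using assms by (subst AE_iff_null) auto
qed

lemma in_restrict_fun:
  assumes "A \<in> sets M"
  shows "(y, B) \<in> restrict_fun M x A \<longleftrightarrow>
    B \<in> sets M \<and> (AE \<omega> in M. (\<omega> \<in> A \<longleftrightarrow> \<omega> \<in> B) \<and> (\<omega> \<in> A \<longrightarrow> x \<omega> = y \<omega>))"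
  (is "_ = ?R")
proof -
  have "(y, B) \<in> restrict_fun M x A \<longleftrightarrow> B \<in> sets M \<and> (AE \<omega> in M. \<omega> \<in> A \<longleftrightarrow> \<omega> \<in> B) \<and>
      (AE \<omega> in M. \<omega> \<in> A \<inter> B \<longrightarrow> x \<omega> = y \<omega>)"
    using assms by (auto simp: restrict_fun_def sym_diff_null_iff)
  also have "\<dots> \<longleftrightarrow> ?R"
    unfolding AE_conj_iff[symmetric] by (intro conj_cong refl AE_cong) auto
  finally show ?thesis .
qed

lemma restrict_fun_eq_iff:
  assumes A: "A \<in> sets M" and B: "B \<in> sets M"
  shows "restrict_fun M x A = restrict_fun M y B \<longleftrightarrow>
    (AE \<omega> in M. (\<omega> \<in> A \<longleftrightarrow> \<omega> \<in> B) \<and> (\<omega> \<in> A \<longrightarrow> x \<omega> = y \<omega>))"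
proof
  assume "restrict_fun M x A = restrict_fun M y B"
  moreover have "(y, B) \<in> restrict_fun M y B"
    using B by (simp add: in_restrict_fun)
  ultimately have "(y, B) \<in> restrict_fun M x A"
    by simp
  then show "AE \<omega> in M. (\<omega> \<in> A \<longleftrightarrow> \<omega> \<in> B) \<and> (\<omega> \<in> A \<longrightarrow> x \<omega> = y \<omega>)"
    unfolding in_restrict_fun[OF A] by blast
next
  assume *: "AE \<omega> in M. (\<omega> \<in> A \<longleftrightarrow> \<omega> \<in> B) \<and> (\<omega> \<in> A \<longrightarrow> x \<omega> = y \<omega>)"
  have "(AE \<omega> in M. (\<omega> \<in> A \<longleftrightarrow> \<omega> \<in> C) \<and> (\<omega> \<in> A \<longrightarrow> x \<omega> = z \<omega>)) \<longleftrightarrow>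
      (AE \<omega> in M. (\<omega> \<in> B \<longleftrightarrow> \<omega> \<in> C) \<and> (\<omega> \<in> B \<longrightarrow> y \<omega> = z \<omega>))" for z C
  proof (rule eventually_subst)
    from * show "AE \<omega> in M. ((\<omega> \<in> A \<longleftrightarrow> \<omega> \<in> C) \<and> (\<omega> \<in> A \<longrightarrow> x \<omega> = z \<omega>)) \<longleftrightarrow>
        ((\<omega> \<in> B \<longleftrightarrow> \<omega> \<in> C) \<and> (\<omega> \<in> B \<longrightarrow> y \<omega> = z \<omega>))"
      by eventually_elim auto
  qed
  then have "(z, C) \<in> restrict_fun M x A \<longleftrightarrow> (z, C) \<in> restrict_fun M y B" for z C
    unfolding in_restrict_fun[OF A] in_restrict_fun[OF B] by simp
  then show "restrict_fun M x A = restrict_fun M y B"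
    by auto
qed

text \<open>
  The relation \<open>x|B \<in> C|B\<close>, together with \<open>B\<close> being almost contained in the event on which \<open>C\<close>
  lives. It refers to the members of the classes that make up \<open>C\<close> rather than to a representation
  \<open>C = V|A\<close>, and is therefore independent of the choice of \<open>V\<close> and \<open>A\<close>.
\<close>

definition locally_in :: "'w measure \<Rightarrow> ('w, 'e) cond_set \<Rightarrow> ('w \<Rightarrow> 'e) \<Rightarrow> 'w set \<Rightarrow> bool" where
  "locally_in M C x B \<longleftrightarrow> (\<exists>(v, A)\<in>\<Union>C. AE \<omega> in M. \<omega> \<in> B \<longrightarrow> \<omega> \<in> A \<and> x \<omega> = v \<omega>)"

lemma locally_in_restrict_set:
  assumes "A \<in> sets M"
  shows "locally_in M (restrict_set M V A) x B \<longleftrightarrow>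
    (\<exists>v\<in>V. AE \<omega> in M. \<omega> \<in> B \<longrightarrow> \<omega> \<in> A \<and> x \<omega> = v \<omega>)" (is "?L \<longleftrightarrow> ?R")
proof
  assume ?L
  then obtain v w E where v: "v \<in> V" "(w, E) \<in> restrict_fun M v A"
    and w: "AE \<omega> in M. \<omega> \<in> B \<longrightarrow> \<omega> \<in> E \<and> x \<omega> = w \<omega>"
    by (auto simp: locally_in_def restrict_set_def)
  from v(2) have "AE \<omega> in M. (\<omega> \<in> A \<longleftrightarrow> \<omega> \<in> E) \<and> (\<omega> \<in> A \<longrightarrow> v \<omega> = w \<omega>)"
    using assms by (simp add: in_restrict_fun)
  with w have "AE \<omega> in M. \<omega> \<in> B \<longrightarrow> \<omega> \<in> A \<and> x \<omega> = v \<omega>"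
    by eventually_elim auto
  with v(1) show ?R by auto
next
  assume ?R
  then obtain v where "v \<in> V" "AE \<omega> in M. \<omega> \<in> B \<longrightarrow> \<omega> \<in> A \<and> x \<omega> = v \<omega>"
    by auto
  moreover have "(v, A) \<in> restrict_fun M v A"
    using assms by (simp add: in_restrict_fun)
  ultimately show ?L
    unfolding locally_in_def restrict_set_def by blast
qed

section \<open>Regions\<close>

text \<open>
  The set \<open>{\<omega>. x \<omega> = y \<omega>}\<close> need not be measurable, since the values of \<open>x\<close> and \<open>y\<close> lie in a plain
  set. The compatibility of the sections at \<open>x\<close> and \<open>y\<close> is therefore demanded on all events \<open>B\<close> on
  which the two functions agree; demanding it on the coincidence set itself would be too strong for
  the regions of conditional sets.
\<close>

definition regions :: "'w measure \<Rightarrow> ('w \<Rightarrow> 'e) set \<Rightarrow> (('w \<Rightarrow> 'e) \<times> 'w) set set" where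
  "regions M X = {S. S \<subseteq> X \<times> space M \<and> (\<forall>x\<in>X. {\<omega> \<in> space M. (x, \<omega>) \<in> S} \<in> sets M) \<and>
     (\<forall>x\<in>X. \<forall>y\<in>X. \<forall>B\<in>sets M. (AE \<omega> in M. \<omega> \<in> B \<longrightarrow> x \<omega> = y \<omega>) \<longrightarrow>
        (AE \<omega> in M. \<omega> \<in> B \<longrightarrow> ((x, \<omega>) \<in> S \<longleftrightarrow> (y, \<omega>) \<in> S)))}"

lemma regions_subset: "S \<in> regions M X \<Longrightarrow> S \<subseteq> X \<times> space M"
  by (simp add: regions_def)

lemma regions_section: "S \<in> regions M X \<Longrightarrow> x \<in> X \<Longrightarrow> {\<omega> \<in> space M. (x, \<omega>) \<in> S} \<in> sets M"
  by (simp add: regions_def)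

lemma regions_extensional:
  "S \<in> regions M X \<Longrightarrow> x \<in> X \<Longrightarrow> y \<in> X \<Longrightarrow> B \<in> sets M \<Longrightarrow> AE \<omega> in M. \<omega> \<in> B \<longrightarrow> x \<omega> = y \<omega> \<Longrightarrow>
    AE \<omega> in M. \<omega> \<in> B \<longrightarrow> ((x, \<omega>) \<in> S \<longleftrightarrow> (y, \<omega>) \<in> S)"
  unfolding regions_def by blast

lemma sigma_algebra_regions: "sigma_algebra (X \<times> space M) (regions M X)"
  unfolding sigma_algebra_iff2
proof (intro conjI ballI allI impI)
  show "regions M X \<subseteq> Pow (X \<times> space M)"
    by (auto dest: regions_subset)
  show "{} \<in> regions M X"
    by (auto simp: regions_def)
next
  fix S assume S: "S \<in> regions M X"
  show "X \<times> space M - S \<in> regions M X"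
    unfolding regions_def
  proof (intro CollectI conjI ballI impI)
    fix x assume x: "x \<in> X"
    have "{\<omega> \<in> space M. (x, \<omega>) \<in> X \<times> space M - S} = space M - {\<omega> \<in> space M. (x, \<omega>) \<in> S}"
      using x by auto
    with regions_section[OF S x] show "{\<omega> \<in> space M. (x, \<omega>) \<in> X \<times> space M - S} \<in> sets M"
      by auto
  next
    fix x y B assume *: "x \<in> X" "y \<in> X" "B \<in> sets M" "AE \<omega> in M. \<omega> \<in> B \<longrightarrow> x \<omega> = y \<omega>"
    from regions_extensional[OF S *]
    show "AE \<omega> in M. \<omega> \<in> B \<longrightarrow> ((x, \<omega>) \<in> X \<times> space M - S \<longleftrightarrow> (y, \<omega>) \<in> X \<times> space M - S)"
      by eventually_elim (use *(1,2) in auto)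
  qed auto
next
  fix S :: "nat \<Rightarrow> _" assume "range S \<subseteq> regions M X"
  then have S: "\<And>n. S n \<in> regions M X" by auto
  show "(\<Union>n. S n) \<in> regions M X"
    unfolding regions_def
  proof (intro CollectI conjI ballI impI)
    show "(\<Union>n. S n) \<subseteq> X \<times> space M"
      using regions_subset[OF S] by auto
    fix x assume x: "x \<in> X"
    have "{\<omega> \<in> space M. (x, \<omega>) \<in> (\<Union>n. S n)} = (\<Union>n. {\<omega> \<in> space M. (x, \<omega>) \<in> S n})"
      by auto
    with regions_section[OF S x] show "{\<omega> \<in> space M. (x, \<omega>) \<in> (\<Union>n. S n)} \<in> sets M"
      by auto
  next
    fix x y B assume "x \<in> X" "y \<in> X" "B \<in> sets M" "AE \<omega> in M. \<omega> \<in> B \<longrightarrow> x \<omega> = y \<omega>"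
    from regions_extensional[OF S this]
    have "AE \<omega> in M. \<forall>n. \<omega> \<in> B \<longrightarrow> ((x, \<omega>) \<in> S n \<longleftrightarrow> (y, \<omega>) \<in> S n)"
      unfolding AE_all_countable by blast
    then show "AE \<omega> in M. \<omega> \<in> B \<longrightarrow> ((x, \<omega>) \<in> (\<Union>n. S n) \<longleftrightarrow> (y, \<omega>) \<in> (\<Union>n. S n))"
      by eventually_elim auto
  qed
qed

lemma cylinder_region:
  assumes "A \<in> sets M" shows "X \<times> A \<in> regions M X"
  unfolding regions_def
proof (intro CollectI conjI ballI impI)
  show "X \<times> A \<subseteq> X \<times> space M"
    using sets.sets_into_space[OF assms] by auto
  fix x assume "x \<in> X"
  then have "{\<omega> \<in> space M. (x, \<omega>) \<in> X \<times> A} = A"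
    using sets.sets_into_space[OF assms] by auto
  with assms show "{\<omega> \<in> space M. (x, \<omega>) \<in> X \<times> A} \<in> sets M" by simp
qed auto

section \<open>Conditional sets as regions\<close>

text \<open>
  The section of \<open>S\<close> at \<open>x\<close> is, up to a null set, the largest event on which \<open>x\<close> belongs to \<open>C\<close>.
\<close>

definition represents ::
    "'w measure \<Rightarrow> ('w \<Rightarrow> 'e) set \<Rightarrow> (('w \<Rightarrow> 'e) \<times> 'w) set \<Rightarrow> ('w, 'e) cond_set \<Rightarrow> bool" where
  "represents M X S C \<longleftrightarrow>
     (\<forall>x\<in>X. \<forall>B\<in>sets M. (AE \<omega> in M. \<omega> \<in> B \<longrightarrow> (x, \<omega>) \<in> S) \<longleftrightarrow> locally_in M C x B)"

definition region_le ::
    "'w measure \<Rightarrow> ('w \<Rightarrow> 'e) set \<Rightarrow> (('w \<Rightarrow> 'e) \<times> 'w) set \<Rightarrow> (('w \<Rightarrow> 'e) \<times> 'w) set \<Rightarrow> bool" where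
  "region_le M X S T \<longleftrightarrow> (\<forall>x\<in>X. AE \<omega> in M. (x, \<omega>) \<in> S \<longrightarrow> (x, \<omega>) \<in> T)"

lemma stable_set_glue:
  assumes "stable_set M V" "is_partition M A" "\<And>k. v k \<in> V"
  obtains u where "u \<in> V" "AE \<omega> in M. \<forall>k. \<omega> \<in> A k \<longrightarrow> u \<omega> = v k \<omega>"
proof -
  obtain u where u: "u \<in> V" "AE \<omega> in M. concat_fun v A \<omega> = u \<omega>"
    using assms unfolding stable_set_def ae_mem_def by blast
  from u(2) have "AE \<omega> in M. \<forall>k. \<omega> \<in> A k \<longrightarrow> u \<omega> = v k \<omega>"
    by eventually_elim (use concat_fun_eq[OF assms(2), of _ _ v] in force)
  with u(1) show thesis by (rule that)
qed

lemma stable_set_glue2: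
  assumes V: "stable_set M V" and B: "B \<in> sets M" and v: "v \<in> V" "w \<in> V"
  obtains u where "u \<in> V" "AE \<omega> in M. (\<omega> \<in> B \<longrightarrow> u \<omega> = v \<omega>) \<and> (\<omega> \<notin> B \<longrightarrow> u \<omega> = w \<omega>)"
proof -
  define A where "A = (\<lambda>k::nat. if k = 0 then B else if k = 1 then space M - B else {})"
  have "is_partition M A"
    using binary_partition[OF B] by (simp add: A_def)
  moreover have "\<And>k::nat. (if k = 0 then v else w) \<in> V"
    using v by auto
  ultimately obtain u where u: "u \<in> V" "AE \<omega> in M. \<forall>k. \<omega> \<in> A k \<longrightarrow> u \<omega> = (if k = 0 then v else w) \<omega>"
    by (rule stable_set_glue[OF V, of A])
  from u(2) AE_space have "AE \<omega> in M. (\<omega> \<in> B \<longrightarrow> u \<omega> = v \<omega>) \<and> (\<omega> \<notin> B \<longrightarrow> u \<omega> = w \<omega>)"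
  proof eventually_elim
    case (elim \<omega>)
    then show ?case
      using elim(1)[rule_format, of 0] elim(1)[rule_format, of 1] by (auto simp: A_def)
  qed
  with u(1) show thesis by (rule that)
qed

text \<open>
  Gluing along events that may overlap: they are first made disjoint, and the event outside of their
  union receives an arbitrary member of \<open>V\<close>.
\<close>

lemma stable_set_glue_sequence:
  fixes B :: "nat \<Rightarrow> 'w set"
  assumes V: "stable_set M V" and B: "range B \<subseteq> sets M" and v: "\<And>n. v n \<in> V"
  obtains u P where "u \<in> V" "\<And>n. P n \<in> sets M" "\<And>n. P n \<subseteq> B n" "(\<Union>n. P n) = (\<Union>n. B n)"
    "AE \<omega> in M. \<forall>n. \<omega> \<in> P n \<longrightarrow> u \<omega> = v n \<omega>"
proof -
  obtain P where P: "is_partition M P" "\<And>n. P (Suc n) \<subseteq> B n" "(\<Union>n. P (Suc n)) = (\<Union>n. B n)"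
    using partition_of_sequence[OF B] by blast
  \<comment> \<open>\<open>P 0\<close> is the event outside of all \<open>B n\<close>; truncated subtraction assigns \<open>v 0\<close> to it\<close>
  have "\<And>k. v (k - 1) \<in> V"
    using v by simp
  then obtain u where u: "u \<in> V" "AE \<omega> in M. \<forall>k. \<omega> \<in> P k \<longrightarrow> u \<omega> = v (k - 1) \<omega>"
    by (rule stable_set_glue[OF V P(1)])
  from u(2) have "AE \<omega> in M. \<forall>n. \<omega> \<in> P (Suc n) \<longrightarrow> u \<omega> = v n \<omega>"
    by eventually_elim auto
  with u(1) partition_sets[OF P(1)] P(2,3) show thesis
    by (intro that[of u "\<lambda>n. P (Suc n)"])
qed

locale stable_base = prob_space M for M :: "'w measure" +
  fixes X :: "('w \<Rightarrow> 'e) set"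
  assumes X: "stable_set M X"
begin

sublocale regions: sigma_algebra "X \<times> space M" "regions M X"
  by (rule sigma_algebra_regions)

lemma X_stable_subset: "X \<in> stable_subsets M X"
  using X by (auto simp: stable_subsets_def ae_mem_def)

lemma cond_setsE:
  assumes "C \<in> cond_sets M X"
  obtains V A where "C = restrict_set M V A" "V \<in> stable_subsets M X" "A \<in> sets M"
  using assms by (auto simp: cond_sets_def)

lemma stable_subsetsD:
  assumes "V \<in> stable_subsets M X"
  shows "stable_set M V" "V \<noteq> {}" "v \<in> V \<Longrightarrow> \<exists>x\<in>X. AE \<omega> in M. v \<omega> = x \<omega>"
  using assms by (auto simp: stable_subsets_def stable_set_def ae_mem_def)

text \<open>
  If \<open>x\<close> agrees with \<open>v n\<close> on \<open>B n\<close>, it agrees on the union with the concatenation of the \<open>v n\<close>, which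
  is again (almost everywhere) a member by stability.
\<close>

lemma locally_in_UN:
  assumes C: "C \<in> cond_sets M X" and B: "range B \<subseteq> sets M" and x: "\<And>n::nat. locally_in M C x (B n)"
  shows "locally_in M C x (\<Union>n. B n)"
proof -
  from C obtain V A where VA: "C = restrict_set M V A" "V \<in> stable_subsets M X" and A: "A \<in> sets M"
    by (rule cond_setsE)
  note V = stable_subsetsD[OF VA(2)]
  from x have "\<forall>n. \<exists>v. v \<in> V \<and> (AE \<omega> in M. \<omega> \<in> B n \<longrightarrow> \<omega> \<in> A \<and> x \<omega> = v \<omega>)"
    unfolding VA(1) locally_in_restrict_set[OF A] by blast
  from choice[OF this]
  obtain v where v: "\<And>n. v n \<in> V" "\<And>n. AE \<omega> in M. \<omega> \<in> B n \<longrightarrow> \<omega> \<in> A \<and> x \<omega> = v n \<omega>"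
    by blast
  obtain u P where u: "u \<in> V" and "\<And>n. P n \<in> sets M" and P: "\<And>n. P n \<subseteq> B n" "(\<Union>n. P n) = (\<Union>n. B n)"
    and uv: "AE \<omega> in M. \<forall>n. \<omega> \<in> P n \<longrightarrow> u \<omega> = v n \<omega>"
    by (rule stable_set_glue_sequence[where v = v, OF V(1) B v(1)]) auto
  have "AE \<omega> in M. \<forall>n. \<omega> \<in> B n \<longrightarrow> \<omega> \<in> A \<and> x \<omega> = v n \<omega>"
    unfolding AE_all_countable using v(2) by blast
  with uv have "AE \<omega> in M. \<omega> \<in> (\<Union>n. B n) \<longrightarrow> \<omega> \<in> A \<and> x \<omega> = u \<omega>"
    unfolding P(2)[symmetric] by eventually_elim (use P(1) in fastforce)
  with u show ?thesis
    unfolding VA(1) locally_in_restrict_set[OF A] by blast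
qed

lemma locally_in_mono:
  assumes "locally_in M C x B" "AE \<omega> in M. \<omega> \<in> B' \<longrightarrow> \<omega> \<in> B \<and> x \<omega> = y \<omega>"
  shows "locally_in M C y B'"
proof -
  from assms(1) obtain v A where "(v, A) \<in> \<Union>C" and v: "AE \<omega> in M. \<omega> \<in> B \<longrightarrow> \<omega> \<in> A \<and> x \<omega> = v \<omega>"
    by (auto simp: locally_in_def)
  moreover from v assms(2) have "AE \<omega> in M. \<omega> \<in> B' \<longrightarrow> \<omega> \<in> A \<and> y \<omega> = v \<omega>"
    by eventually_elim auto
  ultimately show ?thesis
    unfolding locally_in_def by blast
qed

text \<open>
  The section at \<open>x\<close> is obtained by exhaustion from the events on which \<open>x\<close> belongs to \<open>C\<close>. Two
  functions that agree on \<open>B\<close> belong to \<open>C\<close> on the same sub-events of \<open>B\<close>, whence compatibility.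
\<close>

lemma ex_region:
  assumes C: "C \<in> cond_sets M X"
  obtains S where "S \<in> regions M X" "represents M X S C"
proof -
  have "\<exists>D\<in>sets M. locally_in M C x D \<and>
      (\<forall>B\<in>sets M. locally_in M C x B \<longrightarrow> (AE \<omega> in M. \<omega> \<in> B \<longrightarrow> \<omega> \<in> D))" if "x \<in> X" for x
  proof -
    let ?B = "{B\<in>sets M. locally_in M C x B}"
    obtain V A where VA: "C = restrict_set M V A" "V \<in> stable_subsets M X" and A: "A \<in> sets M"
      using C by (rule cond_setsE)
    have "{} \<in> ?B"
      using stable_subsetsD(2)[OF VA(2)] by (auto simp: VA(1) locally_in_restrict_set[OF A])
    moreover have "(\<Union>n. B n) \<in> ?B" if "range B \<subseteq> ?B" for B :: "nat \<Rightarrow> _"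
      using that by (auto intro!: locally_in_UN[OF C])
    ultimately obtain D where "D \<in> ?B" "\<And>B. B \<in> ?B \<Longrightarrow> AE \<omega> in M. \<omega> \<in> B \<longrightarrow> \<omega> \<in> D"
      using exhaustion[of ?B] by blast
    then show ?thesis by blast
  qed
  then have "\<forall>x\<in>X. \<exists>D. D \<in> sets M \<and> locally_in M C x D \<and>
      (\<forall>B\<in>sets M. locally_in M C x B \<longrightarrow> (AE \<omega> in M. \<omega> \<in> B \<longrightarrow> \<omega> \<in> D))"
    by blast
  from bchoice[OF this]
  obtain D where D: "\<And>x. x \<in> X \<Longrightarrow> D x \<in> sets M" "\<And>x. x \<in> X \<Longrightarrow> locally_in M C x (D x)"
    and max: "\<And>x B. x \<in> X \<Longrightarrow> B \<in> sets M \<Longrightarrow> locally_in M C x B \<Longrightarrow> AE \<omega> in M. \<omega> \<in> B \<longrightarrow> \<omega> \<in> D x"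
    by blast
  define S where "S = Sigma X D"
  have repr: "represents M X S C"
    unfolding represents_def
  proof (intro ballI iffI)
    fix x B assume xB: "x \<in> X" "B \<in> sets M"
    { assume "AE \<omega> in M. \<omega> \<in> B \<longrightarrow> (x, \<omega>) \<in> S"
      then have "AE \<omega> in M. \<omega> \<in> B \<longrightarrow> \<omega> \<in> D x \<and> x \<omega> = x \<omega>"
        by eventually_elim (auto simp: S_def)
      then show "locally_in M C x B"
        by (rule locally_in_mono[OF D(2)[OF xB(1)]]) }
    { assume "locally_in M C x B"
      from max[OF xB this] show "AE \<omega> in M. \<omega> \<in> B \<longrightarrow> (x, \<omega>) \<in> S"
        by eventually_elim (auto simp: S_def xB) }
  qed
  have half: "AE \<omega> in M. \<omega> \<in> B \<longrightarrow> \<omega> \<in> D x \<longrightarrow> \<omega> \<in> D y"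
    if "x \<in> X" "y \<in> X" "B \<in> sets M" and eq: "AE \<omega> in M. \<omega> \<in> B \<longrightarrow> x \<omega> = y \<omega>" for x y B
  proof -
    from eq have "AE \<omega> in M. \<omega> \<in> B \<inter> D x \<longrightarrow> \<omega> \<in> D x \<and> x \<omega> = y \<omega>"
      by eventually_elim auto
    then have "locally_in M C y (B \<inter> D x)"
      by (rule locally_in_mono[OF D(2)[OF \<open>x \<in> X\<close>]])
    from max[OF \<open>y \<in> X\<close> _ this] D(1)[OF \<open>x \<in> X\<close>] \<open>B \<in> sets M\<close>
    have "AE \<omega> in M. \<omega> \<in> B \<inter> D x \<longrightarrow> \<omega> \<in> D y"
      by auto
    then show ?thesis
      by eventually_elim auto
  qed
  have "S \<in> regions M X"
    unfolding regions_def
  proof (intro CollectI conjI ballI impI)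
    show "S \<subseteq> X \<times> space M"
      using sets.sets_into_space[OF D(1)] by (auto simp: S_def)
    fix x assume x: "x \<in> X"
    then have "{\<omega> \<in> space M. (x, \<omega>) \<in> S} = D x"
      using sets.sets_into_space[OF D(1)] by (auto simp: S_def)
    with D(1)[OF x] show "{\<omega> \<in> space M. (x, \<omega>) \<in> S} \<in> sets M" by simp
  next
    fix x y B assume *: "x \<in> X" "y \<in> X" "B \<in> sets M" "AE \<omega> in M. \<omega> \<in> B \<longrightarrow> x \<omega> = y \<omega>"
    from *(4) have "AE \<omega> in M. \<omega> \<in> B \<longrightarrow> y \<omega> = x \<omega>"
      by eventually_elim auto
    from half[OF *(2,1,3) this] half[OF *]
    show "AE \<omega> in M. \<omega> \<in> B \<longrightarrow> ((x, \<omega>) \<in> S \<longleftrightarrow> (y, \<omega>) \<in> S)"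
      by eventually_elim (use * in \<open>auto simp: S_def\<close>)
  qed
  with repr show thesis
    using that by blast
qed

text \<open>
  Conversely, let \<open>A\<close> be the essential supremum of the sections of \<open>S\<close>. Gluing shows that it is attained
  by the section at a single \<open>x0\<close>, so that \<open>V = {x. A \<subseteq> S\<^sub>x}\<close> is nonempty, and \<open>V|A\<close> is represented by
  \<open>S\<close>: an \<open>x\<close> that belongs to \<open>S\<close> only on \<open>B\<close> extends to a member of \<open>V\<close> by \<open>x0\<close> outside of \<open>B\<close>.
\<close>

lemma ex_cond_set:
  assumes S: "S \<in> regions M X"
  obtains C where "C \<in> cond_sets M X" "represents M X S C"
proof -
  let ?P = "\<lambda>x B. AE \<omega> in M. \<omega> \<in> B \<longrightarrow> (x, \<omega>) \<in> S"
  let ?B = "{B\<in>sets M. \<exists>x\<in>X. ?P x B}"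
  obtain A where A: "A \<in> ?B" and max: "\<And>B. B \<in> ?B \<Longrightarrow> AE \<omega> in M. \<omega> \<in> B \<longrightarrow> \<omega> \<in> A"
  proof (rule exhaustion[of ?B])
    show "?B \<noteq> {}"
      using X by (auto simp: stable_set_def intro!: exI[of _ "{}"])
    fix B :: "nat \<Rightarrow> _" assume "range B \<subseteq> ?B"
    then have B: "\<And>n. B n \<in> sets M" "\<forall>n. \<exists>x. x \<in> X \<and> ?P x (B n)" by auto
    from choice[OF B(2)] obtain x where x: "\<And>n. x n \<in> X" "\<And>n. ?P (x n) (B n)"
      by blast
    have "range B \<subseteq> sets M" using B(1) by auto
    then obtain y P where y: "y \<in> X" and P: "\<And>n. P n \<in> sets M" "\<And>n. P n \<subseteq> B n" "(\<Union>n. P n) = (\<Union>n. B n)"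
      and yx: "AE \<omega> in M. \<forall>n. \<omega> \<in> P n \<longrightarrow> y \<omega> = x n \<omega>"
      by (rule stable_set_glue_sequence[where v = x, OF X _ x(1)]) auto
    have "AE \<omega> in M. \<omega> \<in> P n \<longrightarrow> (y, \<omega>) \<in> S" for n
    proof -
      from yx have "AE \<omega> in M. \<omega> \<in> P n \<longrightarrow> y \<omega> = x n \<omega>"
        by eventually_elim auto
      from regions_extensional[OF S y x(1) P(1) this] x(2)[of n]
      show ?thesis
        by eventually_elim (use P(2)[of n] in auto)
    qed
    then have "AE \<omega> in M. \<forall>n. \<omega> \<in> P n \<longrightarrow> (y, \<omega>) \<in> S"
      unfolding AE_all_countable by blast
    then have "?P y (\<Union>n. B n)"
      unfolding P(3)[symmetric] by eventually_elim auto
    then show "(\<Union>n. B n) \<in> ?B"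
      using y B(1) by auto
  qed auto
  from A obtain x0 where x0: "x0 \<in> X" "?P x0 A" and Am: "A \<in> sets M" by auto
  define V where "V = {x\<in>X. ?P x A}"
  have "stable_set M V"
    unfolding stable_set_def
  proof (intro conjI allI impI)
    show "V \<noteq> {}" using x0 by (auto simp: V_def)
    fix P and v :: "nat \<Rightarrow> _" assume P: "is_partition M P" and "\<forall>k. v k \<in> V"
    then have v: "\<And>k. v k \<in> X" "\<And>k. ?P (v k) A" by (auto simp: V_def)
    have "ae_mem M (concat_fun v P) X"
      using X P v(1) by (auto simp: stable_set_def)
    then obtain y where y: "y \<in> X" "AE \<omega> in M. concat_fun v P \<omega> = y \<omega>"
      unfolding ae_mem_def by blast
    have "AE \<omega> in M. \<omega> \<in> A \<longrightarrow> (y, \<omega>) \<in> S"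
    proof (rule AE_partitionI[OF P])
      fix k
      from y(2) have "AE \<omega> in M. \<omega> \<in> P k \<longrightarrow> y \<omega> = v k \<omega>"
        by eventually_elim (auto simp: concat_fun_eq[OF P])
      from regions_extensional[OF S y(1) v(1) partition_sets[OF P] this] v(2)[of k]
      show "AE \<omega> in M. \<omega> \<in> P k \<longrightarrow> \<omega> \<in> A \<longrightarrow> (y, \<omega>) \<in> S"
        by eventually_elim auto
    qed
    with y show "ae_mem M (concat_fun v P) V"
      by (auto simp: ae_mem_def V_def)
  qed
  then have V: "V \<in> stable_subsets M X"
    by (auto simp: stable_subsets_def V_def ae_mem_def)
  have "represents M X S (restrict_set M V A)"
    unfolding represents_def locally_in_restrict_set[OF Am]
  proof (intro ballI iffI)
    fix x B assume x: "x \<in> X" and B: "B \<in> sets M"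
    { assume xB: "?P x B"
      with x B have BA: "AE \<omega> in M. \<omega> \<in> B \<longrightarrow> \<omega> \<in> A"
        by (intro max) auto
      obtain v where v: "v \<in> X" "AE \<omega> in M. (\<omega> \<in> B \<longrightarrow> v \<omega> = x \<omega>) \<and> (\<omega> \<notin> B \<longrightarrow> v \<omega> = x0 \<omega>)"
        using stable_set_glue2[OF X B x x0(1)] by blast
      from v(2) have vx: "AE \<omega> in M. \<omega> \<in> B \<longrightarrow> v \<omega> = x \<omega>" by eventually_elim auto
      from v(2) have vx0: "AE \<omega> in M. \<omega> \<in> space M - B \<longrightarrow> v \<omega> = x0 \<omega>" by eventually_elim auto
      have Bc: "space M - B \<in> sets M" using B by auto
      from regions_extensional[OF S v(1) x B vx] regions_extensional[OF S v(1) x0(1) Bc vx0] xB x0(2) AE_space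
      have "?P v A"
        by eventually_elim auto
      then have "v \<in> V" using v(1) by (simp add: V_def)
      moreover from vx BA have "AE \<omega> in M. \<omega> \<in> B \<longrightarrow> \<omega> \<in> A \<and> x \<omega> = v \<omega>"
        by eventually_elim auto
      ultimately show "\<exists>v\<in>V. AE \<omega> in M. \<omega> \<in> B \<longrightarrow> \<omega> \<in> A \<and> x \<omega> = v \<omega>" by blast }
    { assume "\<exists>v\<in>V. AE \<omega> in M. \<omega> \<in> B \<longrightarrow> \<omega> \<in> A \<and> x \<omega> = v \<omega>"
      then obtain v where v: "v \<in> X" "?P v A" and xv: "AE \<omega> in M. \<omega> \<in> B \<longrightarrow> \<omega> \<in> A \<and> x \<omega> = v \<omega>"
        by (auto simp: V_def)
      from xv have "AE \<omega> in M. \<omega> \<in> B \<longrightarrow> x \<omega> = v \<omega>" by eventually_elim auto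
      from regions_extensional[OF S x v(1) B this] v(2) xv
      show "?P x B"
        by eventually_elim auto }
  qed
  moreover have "restrict_set M V A \<in> cond_sets M X"
    using V Am by (auto simp: cond_sets_def)
  ultimately show thesis by (rule that[rotated])
qed

text \<open>
  Conditional inclusion is defined by the existence of suitable representations. It is in fact a
  property of the conditional sets themselves, namely the inclusion of the events of membership.
\<close>

lemma cond_le_iff_locally_in:
  assumes C: "C \<in> cond_sets M X" and D: "D \<in> cond_sets M X"
  shows "cond_le M X C D \<longleftrightarrow> (\<forall>x\<in>X. \<forall>B\<in>sets M. locally_in M C x B \<longrightarrow> locally_in M D x B)"
proof
  assume "cond_le M X C D"
  then obtain V W A B where VW: "C = restrict_set M V A" "D = restrict_set M W B"
      "A - B \<in> null_sets M" "restrict_set M V A \<subseteq> restrict_set M W A"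
      and A: "A \<in> sets M" and B: "B \<in> sets M"
    by (auto simp: cond_le_def)
  show "\<forall>x\<in>X. \<forall>B\<in>sets M. locally_in M C x B \<longrightarrow> locally_in M D x B"
  proof (intro ballI impI)
    fix x E assume "x \<in> X" "E \<in> sets M" "locally_in M C x E"
    then obtain v where v: "v \<in> V" "AE \<omega> in M. \<omega> \<in> E \<longrightarrow> \<omega> \<in> A \<and> x \<omega> = v \<omega>"
      unfolding VW(1) locally_in_restrict_set[OF A] by blast
    obtain w where w: "w \<in> W" "restrict_fun M v A = restrict_fun M w A"
      using VW(4) v(1) by (auto simp: restrict_set_def)
    from w(2) have "AE \<omega> in M. (\<omega> \<in> A \<longleftrightarrow> \<omega> \<in> A) \<and> (\<omega> \<in> A \<longrightarrow> v \<omega> = w \<omega>)"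
      using restrict_fun_eq_iff[OF A A] by blast
    moreover from VW(3) have "AE \<omega> in M. \<omega> \<in> A \<longrightarrow> \<omega> \<in> B"
      using Diff_null_iff[OF A B] by blast
    ultimately have "AE \<omega> in M. \<omega> \<in> E \<longrightarrow> \<omega> \<in> B \<and> x \<omega> = w \<omega>"
      using v(2) by eventually_elim auto
    with w(1) show "locally_in M D x E"
      unfolding VW(2) locally_in_restrict_set[OF B] by blast
  qed
next
  assume *: "\<forall>x\<in>X. \<forall>B\<in>sets M. locally_in M C x B \<longrightarrow> locally_in M D x B"
  obtain V A where VA: "C = restrict_set M V A" "V \<in> stable_subsets M X" and A: "A \<in> sets M"
    using C by (rule cond_setsE)
  note V = stable_subsetsD[OF VA(2)]
  obtain W B where WB: "D = restrict_set M W B" "W \<in> stable_subsets M X" and B: "B \<in> sets M"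
    using D by (rule cond_setsE)
  have key: "\<exists>w\<in>W. AE \<omega> in M. \<omega> \<in> A \<longrightarrow> \<omega> \<in> B \<and> v \<omega> = w \<omega>" if v: "v \<in> V" for v
  proof -
    obtain x where x: "x \<in> X" "AE \<omega> in M. v \<omega> = x \<omega>"
      using V(3)[OF v] by blast
    from x(2) have "AE \<omega> in M. \<omega> \<in> A \<longrightarrow> \<omega> \<in> A \<and> x \<omega> = v \<omega>"
      by eventually_elim auto
    then have "locally_in M C x A"
      unfolding VA(1) locally_in_restrict_set[OF A] using v by blast
    then have "locally_in M D x A"
      using * x(1) A by blast
    then obtain w where w: "w \<in> W" "AE \<omega> in M. \<omega> \<in> A \<longrightarrow> \<omega> \<in> B \<and> x \<omega> = w \<omega>"
      unfolding WB(1) locally_in_restrict_set[OF B] by blast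
    from w(2) x(2) have "AE \<omega> in M. \<omega> \<in> A \<longrightarrow> \<omega> \<in> B \<and> v \<omega> = w \<omega>"
      by eventually_elim auto
    with w(1) show ?thesis by blast
  qed
  obtain v0 where "v0 \<in> V"
    using V(2) by blast
  from key[OF this] obtain w0 where "w0 \<in> W" "AE \<omega> in M. \<omega> \<in> A \<longrightarrow> \<omega> \<in> B \<and> v0 \<omega> = w0 \<omega>"
    by blast
  from this(2) have "AE \<omega> in M. \<omega> \<in> A \<longrightarrow> \<omega> \<in> B"
    by eventually_elim auto
  then have "A - B \<in> null_sets M"
    using Diff_null_iff[OF A B] by blast
  moreover have "restrict_set M V A \<subseteq> restrict_set M W A"
    unfolding restrict_set_def
  proof (intro image_subsetI)
    fix v assume "v \<in> V"
    from key[OF this] obtain w where w: "w \<in> W" "AE \<omega> in M. \<omega> \<in> A \<longrightarrow> \<omega> \<in> B \<and> v \<omega> = w \<omega>"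
      by blast
    from w(2) have "AE \<omega> in M. (\<omega> \<in> A \<longleftrightarrow> \<omega> \<in> A) \<and> (\<omega> \<in> A \<longrightarrow> v \<omega> = w \<omega>)"
      by eventually_elim auto
    then have "restrict_fun M v A = restrict_fun M w A"
      using restrict_fun_eq_iff[OF A A] by blast
    with w(1) show "restrict_fun M v A \<in> (\<lambda>x. restrict_fun M x A) ` W"
      by blast
  qed
  ultimately show "cond_le M X C D"
    unfolding cond_le_def VA(1) WB(1) using VA(2) WB(2) A B by blast
qed

text \<open>
  Mutual inclusion forces the underlying events \<open>A\<close> and \<open>B\<close> to agree almost surely, and restrictions
  to such events are identified.
\<close>

lemma cond_le_antisym:
  assumes CD: "cond_le M X C D" and DC: "cond_le M X D C"
    and C: "C \<in> cond_sets M X" and D: "D \<in> cond_sets M X"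
  shows "C = D"
proof -
  have "C \<subseteq> D" if le: "cond_le M X C D" "cond_le M X D C"
    and C: "C \<in> cond_sets M X" and D: "D \<in> cond_sets M X" for C D
  proof -
    obtain V W A B where VW: "C = restrict_set M V A" "D = restrict_set M W B"
        "A - B \<in> null_sets M" "restrict_set M V A \<subseteq> restrict_set M W A"
        and A: "A \<in> sets M" and B: "B \<in> sets M" and W: "W \<in> stable_subsets M X"
      using le(1) by (auto simp: cond_le_def)
    have AB: "AE \<omega> in M. \<omega> \<in> A \<longrightarrow> \<omega> \<in> B"
      using VW(3) Diff_null_iff[OF A B] by blast
    have "AE \<omega> in M. \<omega> \<in> B \<longrightarrow> \<omega> \<in> A"
    proof -
      obtain w where w: "w \<in> W"
        using W by (auto simp: stable_subsets_def stable_set_def)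
      then obtain x where x: "x \<in> X" "AE \<omega> in M. w \<omega> = x \<omega>"
        using W by (auto simp: stable_subsets_def ae_mem_def)
      from x(2) have "AE \<omega> in M. \<omega> \<in> B \<longrightarrow> \<omega> \<in> B \<and> x \<omega> = w \<omega>"
        by eventually_elim auto
      then have "locally_in M D x B"
        unfolding VW(2) locally_in_restrict_set[OF B] using w by blast
      then have "locally_in M C x B"
        using le(2) cond_le_iff_locally_in[OF D C] x(1) B by blast
      then obtain v where "AE \<omega> in M. \<omega> \<in> B \<longrightarrow> \<omega> \<in> A \<and> x \<omega> = v \<omega>"
        unfolding VW(1) locally_in_restrict_set[OF A] by blast
      then show ?thesis
        by eventually_elim auto
    qed
    with AB have "AE \<omega> in M. (\<omega> \<in> A \<longleftrightarrow> \<omega> \<in> B) \<and> (\<omega> \<in> A \<longrightarrow> w \<omega> = w \<omega>)" for w :: "'w \<Rightarrow> 'e"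
      by eventually_elim auto
    then have "restrict_fun M w A = restrict_fun M w B" for w :: "'w \<Rightarrow> 'e"
      using restrict_fun_eq_iff[OF A B] by blast
    then have "restrict_set M W A = restrict_set M W B"
      by (simp add: restrict_set_def)
    with VW show ?thesis by simp
  qed
  from this[OF CD DC C D] this[OF DC CD D C] show ?thesis by blast
qed

lemma cond_le_iff_region_le:
  assumes "C \<in> cond_sets M X" "D \<in> cond_sets M X"
    and S: "S \<in> regions M X" and SC: "represents M X S C" and TD: "represents M X T D"
  shows "cond_le M X C D \<longleftrightarrow> region_le M X S T"
  unfolding cond_le_iff_locally_in[OF assms(1,2)]
proof
  assume *: "\<forall>x\<in>X. \<forall>B\<in>sets M. locally_in M C x B \<longrightarrow> locally_in M D x B"
  show "region_le M X S T"
    unfolding region_le_def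
  proof
    fix x assume x: "x \<in> X"
    let ?B = "{\<omega> \<in> space M. (x, \<omega>) \<in> S}"
    have B: "?B \<in> sets M" using S x by (rule regions_section)
    have "AE \<omega> in M. \<omega> \<in> ?B \<longrightarrow> (x, \<omega>) \<in> S" by auto
    then have "locally_in M C x ?B"
      using SC x B unfolding represents_def by blast
    then have "locally_in M D x ?B"
      using * x B by blast
    then have "AE \<omega> in M. \<omega> \<in> ?B \<longrightarrow> (x, \<omega>) \<in> T"
      using TD x B unfolding represents_def by blast
    then show "AE \<omega> in M. (x, \<omega>) \<in> S \<longrightarrow> (x, \<omega>) \<in> T"
      using AE_space by eventually_elim auto
  qed
next
  assume ST: "region_le M X S T"
  show "\<forall>x\<in>X. \<forall>B\<in>sets M. locally_in M C x B \<longrightarrow> locally_in M D x B"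
  proof (intro ballI impI)
    fix x B assume x: "x \<in> X" and B: "B \<in> sets M" and "locally_in M C x B"
    then have "AE \<omega> in M. \<omega> \<in> B \<longrightarrow> (x, \<omega>) \<in> S"
      using SC unfolding represents_def by blast
    moreover have "AE \<omega> in M. (x, \<omega>) \<in> S \<longrightarrow> (x, \<omega>) \<in> T"
      using ST x by (simp add: region_le_def)
    ultimately have "AE \<omega> in M. \<omega> \<in> B \<longrightarrow> (x, \<omega>) \<in> T"
      by eventually_elim auto
    then show "locally_in M D x B"
      using TD x B unfolding represents_def by blast
  qed
qed

end

section \<open>Lattice operations and concatenations through regions\<close>

text \<open>
  The inverse of the representation. The choice is immaterial: \<open>cond_of_eqI\<close> shows that a region
  represents only one conditional set.
\<close>

definition cond_of ::
    "'w measure \<Rightarrow> ('w \<Rightarrow> 'e) set \<Rightarrow> (('w \<Rightarrow> 'e) \<times> 'w) set \<Rightarrow> ('w, 'e) cond_set" where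
  "cond_of M X S = (SOME C. C \<in> cond_sets M X \<and> represents M X S C)"

definition regions_of ::
    "'w measure \<Rightarrow> ('w \<Rightarrow> 'e) set \<Rightarrow> ('w, 'e) cond_set set \<Rightarrow> (('w \<Rightarrow> 'e) \<times> 'w) set set" where
  "regions_of M X \<X> = {S \<in> regions M X. cond_of M X S \<in> \<X>}"

context stable_base
begin

lemma
  assumes "S \<in> regions M X"
  shows cond_of_in_cond_sets: "cond_of M X S \<in> cond_sets M X"
    and represents_cond_of: "represents M X S (cond_of M X S)"
proof -
  from ex_cond_set[OF assms] obtain C where "C \<in> cond_sets M X \<and> represents M X S C"
    by blast
  from someI[of "\<lambda>C. C \<in> cond_sets M X \<and> represents M X S C", OF this]
  show "cond_of M X S \<in> cond_sets M X" "represents M X S (cond_of M X S)"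
    by (auto simp: cond_of_def)
qed

lemma region_le_refl: "region_le M X S S"
  by (simp add: region_le_def)

lemma cond_of_eqI:
  assumes S: "S \<in> regions M X" and C: "C \<in> cond_sets M X" and SC: "represents M X S C"
  shows "cond_of M X S = C"
  using region_le_refl[of S] cond_le_iff_region_le[OF _ _ S SC] cond_le_iff_region_le[OF _ _ S _ SC]
    represents_cond_of[OF S] cond_of_in_cond_sets[OF S] C cond_le_iff_region_le[OF C _ S SC]
  by (intro cond_le_antisym) auto

lemma cond_setsE_region:
  assumes "C \<in> cond_sets M X"
  obtains S where "S \<in> regions M X" "C = cond_of M X S"
proof -
  obtain S where S: "S \<in> regions M X" "represents M X S C"
    using assms by (rule ex_region)
  with cond_of_eqI[OF S(1) assms S(2)] show thesis
    by (intro that[of S]) auto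
qed

lemma cond_le_cond_of:
  assumes "S \<in> regions M X" "T \<in> regions M X"
  shows "cond_le M X (cond_of M X S) (cond_of M X T) \<longleftrightarrow> region_le M X S T"
  using assms by (intro cond_le_iff_region_le cond_of_in_cond_sets represents_cond_of)

lemma cond_of_eq_iff:
  assumes "S \<in> regions M X" "T \<in> regions M X"
  shows "cond_of M X S = cond_of M X T \<longleftrightarrow> region_le M X S T \<and> region_le M X T S"
  using cond_le_cond_of[OF assms] cond_le_cond_of[OF assms(2,1)] cond_le_cond_of[OF assms(1,1)]
    region_le_refl cond_le_antisym cond_of_in_cond_sets[OF assms(1)] cond_of_in_cond_sets[OF assms(2)]
  by metis

lemma restrict_set_eq_cond_of_cylinder:
  assumes A: "A \<in> sets M"
  shows "restrict_set M X A = cond_of M X (X \<times> A)"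
proof (rule cond_of_eqI[symmetric, OF cylinder_region[OF A]])
  show "restrict_set M X A \<in> cond_sets M X"
    using X_stable_subset A by (auto simp: cond_sets_def)
  show "represents M X (X \<times> A) (restrict_set M X A)"
    unfolding represents_def locally_in_restrict_set[OF A]
  proof (intro ballI iffI)
    fix x B assume x: "x \<in> X"
    { assume "AE \<omega> in M. \<omega> \<in> B \<longrightarrow> (x, \<omega>) \<in> X \<times> A"
      then have "AE \<omega> in M. \<omega> \<in> B \<longrightarrow> \<omega> \<in> A \<and> x \<omega> = x \<omega>"
        by eventually_elim auto
      with x show "\<exists>v\<in>X. AE \<omega> in M. \<omega> \<in> B \<longrightarrow> \<omega> \<in> A \<and> x \<omega> = v \<omega>" by blast }
    { assume "\<exists>v\<in>X. AE \<omega> in M. \<omega> \<in> B \<longrightarrow> \<omega> \<in> A \<and> x \<omega> = v \<omega>"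
      then obtain v where "AE \<omega> in M. \<omega> \<in> B \<longrightarrow> \<omega> \<in> A \<and> x \<omega> = v \<omega>" by blast
      then show "AE \<omega> in M. \<omega> \<in> B \<longrightarrow> (x, \<omega>) \<in> X \<times> A"
        by eventually_elim (use x in auto) }
  qed
qed

lemma cond_top_eq: "cond_top M X = cond_of M X (X \<times> space M)"
  by (simp add: cond_top_def restrict_set_eq_cond_of_cylinder)

lemma cond_bot_eq: "cond_bot M X = cond_of M X {}"
  using restrict_set_eq_cond_of_cylinder[of "{}"] by (simp add: cond_bot_def)

text \<open>
  The lattice operations are defined by choosing a least upper or greatest lower bound; antisymmetry
  makes the choice unique.
\<close>

lemma cond_Sup_eqI:
  assumes A: "A \<subseteq> cond_sets M X" and U: "U \<in> cond_sets M X" "\<And>C. C \<in> A \<Longrightarrow> cond_le M X C U"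
    and least: "\<And>D. D \<in> cond_sets M X \<Longrightarrow> (\<And>C. C \<in> A \<Longrightarrow> cond_le M X C D) \<Longrightarrow> cond_le M X U D"
  shows "cond_Sup M X A = U"
  unfolding cond_Sup_def Lattice.sup_def
proof (rule some_equality)
  let ?Up = "Upper (cond_order M X) A"
  have Up: "?Up = {D \<in> cond_sets M X. \<forall>C\<in>A. cond_le M X C D}"
    using A by (auto simp: Upper_def cond_order_def)
  show "least (cond_order M X) U ?Up"
    unfolding least_def Up using U least by (auto simp: cond_order_def)
  fix V assume "least (cond_order M X) V ?Up"
  then have "V \<in> ?Up" and *: "\<And>D. D \<in> ?Up \<Longrightarrow> cond_le M X V D"
    unfolding least_def by (auto simp: cond_order_def)
  then show "V = U"
    unfolding Up using U least by (intro cond_le_antisym) auto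
qed

lemma cond_inf_eqI:
  assumes CD: "C \<in> cond_sets M X" "D \<in> cond_sets M X"
    and L: "L \<in> cond_sets M X" "cond_le M X L C" "cond_le M X L D"
    and greatest: "\<And>E. E \<in> cond_sets M X \<Longrightarrow> cond_le M X E C \<Longrightarrow> cond_le M X E D \<Longrightarrow> cond_le M X E L"
  shows "cond_inf M X C D = L"
  unfolding cond_inf_def meet_def Lattice.inf_def
proof (rule some_equality)
  let ?Lo = "Lower (cond_order M X) {C, D}"
  have Lo: "?Lo = {E \<in> cond_sets M X. cond_le M X E C \<and> cond_le M X E D}"
    using CD by (auto simp: Lower_def cond_order_def)
  show "greatest (cond_order M X) L ?Lo"
    unfolding greatest_def Lo using L greatest by (auto simp: cond_order_def)
  fix V assume "greatest (cond_order M X) V ?Lo"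
  then have "V \<in> ?Lo" and *: "\<And>E. E \<in> ?Lo \<Longrightarrow> cond_le M X E V"
    unfolding greatest_def by (auto simp: cond_order_def)
  then show "V = L"
    unfolding Lo using L greatest by (intro cond_le_antisym) auto
qed

lemma region_le_UN:
  fixes S :: "nat \<Rightarrow> _"
  assumes "\<And>n. region_le M X (S n) T" shows "region_le M X (\<Union>n. S n) T"
  unfolding region_le_def
proof
  fix x assume "x \<in> X"
  with assms have "AE \<omega> in M. \<forall>n. (x, \<omega>) \<in> S n \<longrightarrow> (x, \<omega>) \<in> T"
    unfolding AE_all_countable region_le_def by blast
  then show "AE \<omega> in M. (x, \<omega>) \<in> (\<Union>n. S n) \<longrightarrow> (x, \<omega>) \<in> T"
    by eventually_elim auto
qed

lemma region_le_mono: "S \<subseteq> T \<Longrightarrow> region_le M X S T"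
  by (auto simp: region_le_def)

lemma region_le_Diff:
  assumes "region_le M X S T" shows "region_le M X (S - T) {}"
  unfolding region_le_def
proof
  fix x assume "x \<in> X"
  with assms have "AE \<omega> in M. (x, \<omega>) \<in> S \<longrightarrow> (x, \<omega>) \<in> T"
    by (simp add: region_le_def)
  then show "AE \<omega> in M. (x, \<omega>) \<in> S - T \<longrightarrow> (x, \<omega>) \<in> {}"
    by eventually_elim auto
qed

text \<open>
  Only countably many null sets have to be collected at each \<open>x\<close>, so the union of the regions is a
  least upper bound. An uncountable union need not even have measurable sections.
\<close>

lemma cond_Sup_cond_of:
  fixes S :: "nat \<Rightarrow> _"
  assumes S: "\<And>n. S n \<in> regions M X"
  shows "cond_Sup M X (range (\<lambda>n. cond_of M X (S n))) = cond_of M X (\<Union>n. S n)"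
proof (rule cond_Sup_eqI)
  have U: "(\<Union>n. S n) \<in> regions M X"
    using S by auto
  show "range (\<lambda>n. cond_of M X (S n)) \<subseteq> cond_sets M X" "cond_of M X (\<Union>n. S n) \<in> cond_sets M X"
    using S U by (auto intro: cond_of_in_cond_sets)
  fix D
  have "cond_le M X (cond_of M X (S n)) (cond_of M X (\<Union>n. S n))" for n
    unfolding cond_le_cond_of[OF S U] by (intro region_le_mono UN_upper) simp
  then show "D \<in> range (\<lambda>n. cond_of M X (S n)) \<Longrightarrow> cond_le M X D (cond_of M X (\<Union>n. S n))"
    by auto
  assume "D \<in> cond_sets M X" and le: "\<And>C. C \<in> range (\<lambda>n. cond_of M X (S n)) \<Longrightarrow> cond_le M X C D"
  then obtain T where T: "T \<in> regions M X" "D = cond_of M X T"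
    by (blast elim: cond_setsE_region)
  with le S have "region_le M X (S n) T" for n
    by (subst cond_le_cond_of[symmetric]) auto
  from region_le_UN[OF this] show "cond_le M X (cond_of M X (\<Union>n. S n)) D"
    unfolding T(2) cond_le_cond_of[OF U T(1)] .
qed

lemma cond_sup_cond_of:
  assumes S: "S \<in> regions M X" and T: "T \<in> regions M X"
  shows "cond_sup M X (cond_of M X S) (cond_of M X T) = cond_of M X (S \<union> T)"
proof -
  have range2: "range (\<lambda>n::nat. if n = 0 then a else b) = {a, b}" for a b :: "('w, 'e) cond_set"
    by (auto simp: image_iff intro: exI[of _ 1])
  have "range (\<lambda>n::nat. cond_of M X (if n = 0 then S else T)) = {cond_of M X S, cond_of M X T}"
    unfolding if_distrib[of "cond_of M X"] by (rule range2)
  moreover have "(\<Union>n::nat. if n = 0 then S else T) = S \<union> T"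
    by (auto split: if_splits)
  ultimately show ?thesis
    using cond_Sup_cond_of[of "\<lambda>n. if n = 0 then S else T"] S T
    by (simp add: cond_sup_def join_def cond_Sup_def)
qed

lemma cond_inf_cond_of:
  assumes S: "S \<in> regions M X" and T: "T \<in> regions M X"
  shows "cond_inf M X (cond_of M X S) (cond_of M X T) = cond_of M X (S \<inter> T)"
proof (rule cond_inf_eqI)
  have ST: "S \<inter> T \<in> regions M X"
    using S T by auto
  show "cond_of M X S \<in> cond_sets M X" "cond_of M X T \<in> cond_sets M X" "cond_of M X (S \<inter> T) \<in> cond_sets M X"
    using S T ST by (auto intro: cond_of_in_cond_sets)
  show "cond_le M X (cond_of M X (S \<inter> T)) (cond_of M X S)" "cond_le M X (cond_of M X (S \<inter> T)) (cond_of M X T)"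
    using S T ST by (auto simp: cond_le_cond_of intro!: region_le_mono)
  fix E assume "E \<in> cond_sets M X" and le: "cond_le M X E (cond_of M X S)" "cond_le M X E (cond_of M X T)"
  then obtain U where U: "U \<in> regions M X" "E = cond_of M X U"
    by (blast elim: cond_setsE_region)
  with le S T have "region_le M X U S" "region_le M X U T"
    by (simp_all add: cond_le_cond_of)
  have "region_le M X U (S \<inter> T)"
    unfolding region_le_def
  proof
    fix x assume "x \<in> X"
    with \<open>region_le M X U S\<close> \<open>region_le M X U T\<close>
    have "AE \<omega> in M. (x, \<omega>) \<in> U \<longrightarrow> (x, \<omega>) \<in> S" "AE \<omega> in M. (x, \<omega>) \<in> U \<longrightarrow> (x, \<omega>) \<in> T"
      by (simp_all add: region_le_def)
    then show "AE \<omega> in M. (x, \<omega>) \<in> U \<longrightarrow> (x, \<omega>) \<in> S \<inter> T"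
      by eventually_elim auto
  qed
  then show "cond_le M X E (cond_of M X (S \<inter> T))"
    unfolding U(2) cond_le_cond_of[OF U(1) ST] .
qed

lemma cond_inf_eq_bot_iff:
  assumes "S \<in> regions M X" "T \<in> regions M X"
  shows "cond_inf M X (cond_of M X S) (cond_of M X T) = cond_bot M X \<longleftrightarrow> region_le M X (S \<inter> T) {}"
proof -
  have "S \<inter> T \<in> regions M X" "{} \<in> regions M X"
    using assms by auto
  then show ?thesis
    using assms region_le_mono[of "{}" "S \<inter> T"]
    by (simp add: cond_inf_cond_of cond_bot_eq cond_of_eq_iff)
qed

text \<open>
  A complement \<open>T\<close> of \<open>S\<close> satisfies \<open>S \<union> T = X \<times> \<Omega>\<close> and \<open>S \<inter> T = {}\<close> up to null sections, which
  leaves no freedom for its sections.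
\<close>

lemma cond_compl_cond_of:
  assumes S: "S \<in> regions M X"
  shows "cond_compl M X (cond_of M X S) = cond_of M X (X \<times> space M - S)"
  unfolding cond_compl_def
proof (rule the_equality)
  have Sc: "X \<times> space M - S \<in> regions M X"
    using S by auto
  have "S \<union> (X \<times> space M - S) = X \<times> space M" "S \<inter> (X \<times> space M - S) = {}"
    using regions_subset[OF S] by auto
  then show "cond_of M X (X \<times> space M - S) \<in> cond_sets M X \<and>
      cond_sup M X (cond_of M X S) (cond_of M X (X \<times> space M - S)) = cond_top M X \<and>
      cond_inf M X (cond_of M X S) (cond_of M X (X \<times> space M - S)) = cond_bot M X"
    using S Sc by (simp add: cond_sup_cond_of cond_inf_cond_of cond_top_eq cond_bot_eq cond_of_in_cond_sets)
  fix D assume D: "D \<in> cond_sets M X \<and> cond_sup M X (cond_of M X S) D = cond_top M X \<and>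
      cond_inf M X (cond_of M X S) D = cond_bot M X"
  then obtain T where T: "T \<in> regions M X" "D = cond_of M X T"
    by (blast elim: cond_setsE_region)
  have "cond_of M X (S \<union> T) = cond_of M X (X \<times> space M)" "cond_of M X (S \<inter> T) = cond_of M X {}"
    using D S T by (simp_all add: cond_sup_cond_of cond_inf_cond_of cond_top_eq cond_bot_eq)
  then have un: "region_le M X (X \<times> space M) (S \<union> T)" and int: "region_le M X (S \<inter> T) {}"
    using cond_of_eq_iff[of "S \<union> T" "X \<times> space M"] cond_of_eq_iff[of "S \<inter> T" "{}"] S T by auto
  have "region_le M X (X \<times> space M - S) T"
    unfolding region_le_def
  proof
    fix x assume "x \<in> X"
    with un have "AE \<omega> in M. (x, \<omega>) \<in> X \<times> space M \<longrightarrow> (x, \<omega>) \<in> S \<union> T" by (simp only: region_le_def)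
    then show "AE \<omega> in M. (x, \<omega>) \<in> X \<times> space M - S \<longrightarrow> (x, \<omega>) \<in> T"
      by eventually_elim auto
  qed
  moreover have "region_le M X T (X \<times> space M - S)"
    unfolding region_le_def
  proof
    fix x assume "x \<in> X"
    with int have "AE \<omega> in M. (x, \<omega>) \<in> S \<inter> T \<longrightarrow> (x, \<omega>) \<in> {}" by (simp only: region_le_def)
    then show "AE \<omega> in M. (x, \<omega>) \<in> T \<longrightarrow> (x, \<omega>) \<in> X \<times> space M - S"
      by eventually_elim (use regions_subset[OF T(1)] in auto)
  qed
  ultimately show "D = cond_of M X (X \<times> space M - S)"
    using T Sc by (simp add: cond_of_eq_iff)
qed

text \<open>
  A double concatenation, along \<open>P\<close> of functions glued along \<open>A\<close>, is regrouped: for each \<open>k\<close> one first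
  glues the \<open>k\<close>-th pieces along \<open>P\<close> inside \<open>V k\<close>.
\<close>

lemma concat_set_stable_subset:
  assumes V: "\<And>k. V k \<in> stable_subsets M X" and A: "is_partition M A"
  shows "concat_set V A \<in> stable_subsets M X"
proof -
  note VD = stable_subsetsD[OF V]
  have "stable_set M (concat_set V A)"
    unfolding stable_set_def
  proof (intro conjI allI impI)
    have "\<forall>k. \<exists>v. v \<in> V k"
      using VD(2) by blast
    from choice[OF this] show "concat_set V A \<noteq> {}"
      by (auto simp: concat_set_def)
    fix P and u :: "nat \<Rightarrow> _" assume P: "is_partition M P" and "\<forall>n. u n \<in> concat_set V A"
    then have "\<forall>n. \<exists>v. u n = concat_fun v A \<and> (\<forall>k. v k \<in> V k)"
      by (auto simp: concat_set_def)
    from choice[OF this] obtain v where v: "\<And>n. u n = concat_fun (v n) A" "\<And>n k. v n k \<in> V k"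
      by blast
    have "\<forall>k. \<exists>w. w \<in> V k \<and> (AE \<omega> in M. concat_fun (\<lambda>n. v n k) P \<omega> = w \<omega>)"
    proof
      fix k
      have "ae_mem M (concat_fun (\<lambda>n. v n k) P) (V k)"
        using VD(1)[of k] P v(2) by (simp add: stable_set_def)
      then show "\<exists>w. w \<in> V k \<and> (AE \<omega> in M. concat_fun (\<lambda>n. v n k) P \<omega> = w \<omega>)"
        unfolding ae_mem_def by blast
    qed
    from choice[OF this]
    obtain w where w: "\<And>k. w k \<in> V k" "\<And>k. AE \<omega> in M. concat_fun (\<lambda>n. v n k) P \<omega> = w k \<omega>"
      by blast
    have "AE \<omega> in M. concat_fun u P \<omega> = concat_fun w A \<omega>"
    proof (rule AE_partitionI[OF A])
      fix k
      show "AE \<omega> in M. \<omega> \<in> A k \<longrightarrow> concat_fun u P \<omega> = concat_fun w A \<omega>"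
      proof (rule AE_partitionI[OF P])
        fix n
        from w(2)[of k]
        show "AE \<omega> in M. \<omega> \<in> P n \<longrightarrow> \<omega> \<in> A k \<longrightarrow> concat_fun u P \<omega> = concat_fun w A \<omega>"
          by eventually_elim (auto simp: concat_fun_eq[OF A] concat_fun_eq[OF P] v(1))
      qed
    qed
    moreover have "concat_fun w A \<in> concat_set V A"
      using w(1) by (auto simp: concat_set_def)
    ultimately show "ae_mem M (concat_fun u P) (concat_set V A)"
      by (auto simp: ae_mem_def)
  qed
  moreover have "ae_mem M u X" if "u \<in> concat_set V A" for u
  proof -
    from that obtain v where v: "u = concat_fun v A" "\<And>k. v k \<in> V k"
      by (auto simp: concat_set_def)
    have "\<forall>k. \<exists>x. x \<in> X \<and> (AE \<omega> in M. v k \<omega> = x \<omega>)"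
      using VD(3)[OF v(2)] by blast
    from choice[OF this] obtain x where x: "\<And>k. x k \<in> X" "\<And>k. AE \<omega> in M. v k \<omega> = x k \<omega>"
      by blast
    from stable_set_glue[OF X A x(1)] obtain y where y: "y \<in> X" "AE \<omega> in M. \<forall>k. \<omega> \<in> A k \<longrightarrow> y \<omega> = x k \<omega>" .
    have "AE \<omega> in M. u \<omega> = y \<omega>"
    proof (rule AE_partitionI[OF A])
      fix k
      from y(2) x(2)[of k] show "AE \<omega> in M. \<omega> \<in> A k \<longrightarrow> u \<omega> = y \<omega>"
        by eventually_elim (auto simp: v(1) concat_fun_eq[OF A])
    qed
    with y(1) show ?thesis
      by (auto simp: ae_mem_def)
  qed
  ultimately show ?thesis
    by (simp add: stable_subsets_def)
qed

lemma concat_region: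
  assumes S: "\<And>k. S k \<in> regions M X" and A: "is_partition M A"
  shows "(\<Union>k::nat. S k \<inter> X \<times> A k) \<in> regions M X"
  using S cylinder_region[OF partition_sets[OF A]] by (auto intro!: regions.countable_UN)

text \<open>
  On the \<open>k\<close>-th event of the partition, a function belongs to the concatenation exactly if it belongs to
  the \<open>k\<close>-th conditional set. So the region of the concatenation is made of slices.
\<close>

lemma cond_concat_eq:
  assumes V: "\<And>k. V k \<in> stable_subsets M X" and B: "\<And>k. B k \<in> sets M"
    and S: "\<And>k. S k \<in> regions M X" and VS: "\<And>k. restrict_set M (V k) (B k) = cond_of M X (S k)"
    and A: "is_partition M A"
  shows "cond_concat M V B A = cond_of M X (\<Union>k. S k \<inter> X \<times> A k)"
proof (rule cond_of_eqI[OF concat_region[OF S A], symmetric])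
  let ?D = "\<Union>k. A k \<inter> B k"
  have D: "?D \<in> sets M"
    using partition_sets[OF A] B by auto
  show "cond_concat M V B A \<in> cond_sets M X"
    using concat_set_stable_subset[of V, OF V A] D by (auto simp: cond_concat_def cond_sets_def)
  have loc: "(AE \<omega> in M. \<omega> \<in> E \<longrightarrow> (x, \<omega>) \<in> S k) \<longleftrightarrow>
      (\<exists>v\<in>V k. AE \<omega> in M. \<omega> \<in> E \<longrightarrow> \<omega> \<in> B k \<and> x \<omega> = v \<omega>)" if "x \<in> X" "E \<in> sets M" for x E k
    using represents_cond_of[OF S[of k]] that
    unfolding represents_def VS[symmetric] locally_in_restrict_set[OF B] by blast
  show "represents M X (\<Union>k. S k \<inter> X \<times> A k) (cond_concat M V B A)"
    unfolding represents_def cond_concat_def locally_in_restrict_set[OF D]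
  proof (intro ballI iffI)
    fix x E assume x: "x \<in> X" and E: "E \<in> sets M"
    have EA: "E \<inter> A k \<in> sets M" for k
      using E partition_sets[OF A] by auto
    { assume xE: "AE \<omega> in M. \<omega> \<in> E \<longrightarrow> (x, \<omega>) \<in> (\<Union>k. S k \<inter> X \<times> A k)"
      have "\<forall>k. \<exists>v. v \<in> V k \<and> (AE \<omega> in M. \<omega> \<in> E \<inter> A k \<longrightarrow> \<omega> \<in> B k \<and> x \<omega> = v \<omega>)"
      proof
        fix k
        from xE have "AE \<omega> in M. \<omega> \<in> E \<inter> A k \<longrightarrow> (x, \<omega>) \<in> S k"
          by eventually_elim (use partition_unique[OF A] in blast)
        then show "\<exists>v. v \<in> V k \<and> (AE \<omega> in M. \<omega> \<in> E \<inter> A k \<longrightarrow> \<omega> \<in> B k \<and> x \<omega> = v \<omega>)"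
          using loc[OF x EA] by blast
      qed
      from choice[OF this]
      obtain v where v: "\<And>k. v k \<in> V k" "\<And>k. AE \<omega> in M. \<omega> \<in> E \<inter> A k \<longrightarrow> \<omega> \<in> B k \<and> x \<omega> = v k \<omega>"
        by blast
      have "AE \<omega> in M. \<omega> \<in> E \<longrightarrow> \<omega> \<in> ?D \<and> x \<omega> = concat_fun v A \<omega>"
      proof (rule AE_partitionI[OF A])
        fix k
        from v(2)[of k] show "AE \<omega> in M. \<omega> \<in> A k \<longrightarrow> \<omega> \<in> E \<longrightarrow> \<omega> \<in> ?D \<and> x \<omega> = concat_fun v A \<omega>"
          by eventually_elim (auto simp: concat_fun_eq[OF A])
      qed
      moreover have "concat_fun v A \<in> concat_set V A"
        using v(1) by (auto simp: concat_set_def)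
      ultimately show "\<exists>u\<in>concat_set V A. AE \<omega> in M. \<omega> \<in> E \<longrightarrow> \<omega> \<in> ?D \<and> x \<omega> = u \<omega>"
        by blast }
    { assume "\<exists>u\<in>concat_set V A. AE \<omega> in M. \<omega> \<in> E \<longrightarrow> \<omega> \<in> ?D \<and> x \<omega> = u \<omega>"
      then obtain v where v: "\<And>k. v k \<in> V k"
        and xv: "AE \<omega> in M. \<omega> \<in> E \<longrightarrow> \<omega> \<in> ?D \<and> x \<omega> = concat_fun v A \<omega>"
        by (auto simp: concat_set_def)
      show "AE \<omega> in M. \<omega> \<in> E \<longrightarrow> (x, \<omega>) \<in> (\<Union>k. S k \<inter> X \<times> A k)"
      proof (rule AE_partitionI[OF A])
        fix k
        from xv have "AE \<omega> in M. \<omega> \<in> E \<inter> A k \<longrightarrow> \<omega> \<in> B k \<and> x \<omega> = v k \<omega>"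
        proof eventually_elim
          case (elim \<omega>)
          then show ?case
            using partition_unique[OF A, of \<omega>] by (auto simp: concat_fun_eq[OF A])
        qed
        with v have "AE \<omega> in M. \<omega> \<in> E \<inter> A k \<longrightarrow> (x, \<omega>) \<in> S k"
          using loc[OF x EA] by blast
        then show "AE \<omega> in M. \<omega> \<in> A k \<longrightarrow> \<omega> \<in> E \<longrightarrow> (x, \<omega>) \<in> (\<Union>k. S k \<inter> X \<times> A k)"
          by eventually_elim (use x in auto)
      qed }
  qed
qed

end

section \<open>Stable collections as collections of regions\<close>

context stable_base
begin

lemma regions_ofD:
  assumes "S \<in> regions_of M X \<X>" shows "S \<in> regions M X" "cond_of M X S \<in> \<X>"
  using assms by (auto simp: regions_of_def)

lemma regions_of_null_change:
  assumes "S \<in> regions M X" "T \<in> regions_of M X \<X>" "region_le M X S T" "region_le M X T S"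
  shows "S \<in> regions_of M X \<X>"
  using assms cond_of_eq_iff[of S T] by (simp add: regions_of_def)

text \<open>
  Stable collections and stable functions quantify over representations \<open>V|B\<close>. Choosing them allows
  these closure properties to be used on regions.
\<close>

lemma representatives:
  assumes S: "\<And>k::nat. S k \<in> regions M X"
  obtains V B where "\<And>k. V k \<in> stable_subsets M X" "\<And>k. B k \<in> sets M"
    "\<And>k. restrict_set M (V k) (B k) = cond_of M X (S k)"
proof -
  have "\<forall>k. \<exists>VB. fst VB \<in> stable_subsets M X \<and> snd VB \<in> sets M \<and>
      restrict_set M (fst VB) (snd VB) = cond_of M X (S k)"
    using cond_of_in_cond_sets[OF S] by (force simp: cond_sets_def)
  from choice[OF this] obtain f where "\<forall>k. fst (f k) \<in> stable_subsets M X \<and> snd (f k) \<in> sets M \<and>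
      restrict_set M (fst (f k)) (snd (f k)) = cond_of M X (S k)" ..
  then show thesis
    by (intro that[of "\<lambda>k. fst (f k)" "\<lambda>k. snd (f k)"]) auto
qed

lemma regions_of_concat:
  assumes \<X>: "stable_collection M X \<X>" and S: "\<And>k. S k \<in> regions_of M X \<X>" and A: "is_partition M A"
  shows "(\<Union>k::nat. S k \<inter> X \<times> A k) \<in> regions_of M X \<X>"
proof -
  note Sr = regions_ofD[OF S]
  obtain V B where VB: "\<And>k. V k \<in> stable_subsets M X" "\<And>k. B k \<in> sets M"
    "\<And>k. restrict_set M (V k) (B k) = cond_of M X (S k)"
    using representatives[of S, OF Sr(1)] by blast
  have "cond_concat M V B A \<in> \<X>"
    using \<X> A VB Sr(2) by (auto simp: stable_collection_def)
  then show ?thesis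
    using cond_concat_eq[OF VB(1,2) Sr(1) VB(3) A] concat_region[of S, OF Sr(1) A]
    by (simp add: regions_of_def)
qed

lemma stable_function_concat:
  assumes \<mu>: "stable_function M X \<X> \<mu>" and S: "\<And>k. S k \<in> regions_of M X \<X>" and A: "is_partition M A"
  shows "AE \<omega> in M. \<mu> (cond_of M X (\<Union>k::nat. S k \<inter> X \<times> A k)) \<omega> = concat_fun (\<lambda>k. \<mu> (cond_of M X (S k))) A \<omega>"
proof -
  note Sr = regions_ofD[OF S]
  obtain V B where VB: "\<And>k. V k \<in> stable_subsets M X" "\<And>k. B k \<in> sets M"
    "\<And>k. restrict_set M (V k) (B k) = cond_of M X (S k)"
    using representatives[of S, OF Sr(1)] by blast
  have "AE \<omega> in M. \<mu> (cond_concat M V B A) \<omega> = concat_fun (\<lambda>k. \<mu> (restrict_set M (V k) (B k))) A \<omega>"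
    by (rule \<mu>[unfolded stable_function_def, THEN conjunct2, THEN conjunct2, rule_format])
       (use A VB Sr(2) in auto)
  then show ?thesis
    unfolding cond_concat_eq[OF VB(1,2) Sr(1) VB(3) A] VB(3) .
qed

lemma ring_of_sets_regions_of:
  assumes \<X>: "stable_ring M X \<X>"
  shows "ring_of_sets (X \<times> space M) (regions_of M X \<X>)"
proof -
  let ?R = "regions_of M X \<X>"
  have Un: "S \<union> T \<in> ?R" if "S \<in> ?R" "T \<in> ?R" for S T
  proof -
    note S = regions_ofD[OF that(1)] and T = regions_ofD[OF that(2)]
    have "cond_sup M X (cond_of M X S) (cond_of M X T) \<in> \<X>"
      using \<X> S T by (auto simp: stable_ring_def)
    then show ?thesis
      using S T by (auto simp: regions_of_def cond_sup_cond_of)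
  qed
  have Diff: "S - T \<in> ?R" if "S \<in> ?R" "T \<in> ?R" for S T
  proof -
    note S = regions_ofD[OF that(1)] and T = regions_ofD[OF that(2)]
    have "S \<inter> (X \<times> space M - T) = S - T"
      using regions_subset[OF S(1)] by auto
    moreover have "X \<times> space M - T \<in> regions M X"
      using T(1) by auto
    ultimately have "cond_of M X (S - T) = cond_inf M X (cond_of M X S) (cond_compl M X (cond_of M X T))"
      using S T by (simp add: cond_compl_cond_of cond_inf_cond_of)
    also have "\<dots> \<in> \<X>"
      using \<X> S T by (auto simp: stable_ring_def)
    finally show ?thesis
      using S T by (auto simp: regions_of_def)
  qed
  obtain C where "C \<in> \<X>" "C \<in> cond_sets M X"
    using \<X> unfolding stable_ring_def stable_collection_def by blast
  then obtain S where "S \<in> ?R"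
    unfolding regions_of_def by (auto elim!: cond_setsE_region)
  from Diff[OF this this] have "{} \<in> ?R"
    by simp
  then show ?thesis
    unfolding ring_of_sets_iff using Un Diff by (auto simp: regions_of_def dest: regions_subset)
qed

lemma stable_sigma_algebra_regions_of:
  assumes \<S>: "stable_sigma_algebra M X \<S>"
  shows "sigma_algebra (X \<times> space M) (regions_of M X \<S>)"
  unfolding sigma_algebra_iff2
proof (intro conjI ballI allI impI)
  let ?R = "regions_of M X \<S>"
  show "?R \<subseteq> Pow (X \<times> space M)"
    by (auto simp: regions_of_def dest: regions_subset)
  show compl: "X \<times> space M - S \<in> ?R" if "S \<in> ?R" for S
  proof -
    note S = regions_ofD[OF that]
    have "cond_compl M X (cond_of M X S) \<in> \<S>"
      using \<S> S by (auto simp: stable_sigma_algebra_def)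
    then show ?thesis
      using S by (auto simp: regions_of_def cond_compl_cond_of)
  qed
  have "X \<times> space M \<in> ?R"
    using \<S> by (auto simp: regions_of_def stable_sigma_algebra_def cond_top_eq)
  from compl[OF this] show "{} \<in> ?R"
    by simp
  fix S :: "nat \<Rightarrow> _" assume "range S \<subseteq> ?R"
  then have S: "\<And>n. S n \<in> regions M X" "\<And>n. cond_of M X (S n) \<in> \<S>"
    by (auto simp: regions_of_def)
  have "range (\<lambda>n. cond_of M X (S n)) \<subseteq> \<S>"
    using S(2) by auto
  then have "cond_Sup M X (range (\<lambda>n. cond_of M X (S n))) \<in> \<S>"
    using \<S> by (simp add: stable_sigma_algebra_def)
  then have "cond_of M X (\<Union>n. S n) \<in> \<S>"
    by (simp only: cond_Sup_cond_of[OF S(1)])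
  then show "(\<Union>n. S n) \<in> ?R"
    using S(1) by (auto simp: regions_of_def)
qed

text \<open>
  The counterpart of \<open>stable_sigma_algebra_regions_of\<close>. The cylinders are what stability adds to an
  ordinary \<open>\<sigma>\<close>-algebra of regions: with them, concatenations are countable unions of measurable slices.
\<close>

lemma stable_sigma_algebraI:
  assumes sub: "\<S> \<subseteq> cond_sets M X"
    and sig: "sigma_algebra (X \<times> space M) (regions_of M X \<S>)"
    and cyl: "\<And>A. A \<in> sets M \<Longrightarrow> X \<times> A \<in> regions_of M X \<S>"
  shows "stable_sigma_algebra M X \<S>"
proof -
  interpret R: sigma_algebra "X \<times> space M" "regions_of M X \<S>"
    by (rule sig)
  have region: "\<exists>S. S \<in> regions_of M X \<S> \<and> C = cond_of M X S" if "C \<in> \<S>" for C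
    using that sub by (auto simp: regions_of_def elim!: cond_setsE_region)
  have top: "cond_top M X \<in> \<S>"
    using cyl[of "space M"] by (auto simp: cond_top_eq regions_of_def)
  have "stable_collection M X \<S>"
    unfolding stable_collection_def
  proof (intro conjI allI impI)
    show "\<S> \<noteq> {}" using top by auto
    fix V :: "nat \<Rightarrow> _" and B and A :: "nat \<Rightarrow> _"
    assume VB: "\<forall>k. V k \<in> stable_subsets M X \<and> B k \<in> sets M \<and> restrict_set M (V k) (B k) \<in> \<S>"
      and A: "is_partition M A"
    then have "\<forall>k. \<exists>S. S \<in> regions_of M X \<S> \<and> restrict_set M (V k) (B k) = cond_of M X S"
      using region by blast
    from choice[OF this] obtain S where S: "\<And>k. S k \<in> regions_of M X \<S>"
      "\<And>k. restrict_set M (V k) (B k) = cond_of M X (S k)"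
      by blast
    have "(\<Union>k. S k \<inter> X \<times> A k) \<in> regions_of M X \<S>"
      using S(1) cyl[OF partition_sets[OF A]] by auto
    moreover have "cond_concat M V B A = cond_of M X (\<Union>k. S k \<inter> X \<times> A k)"
      using VB S A by (intro cond_concat_eq) (auto simp: regions_of_def)
    ultimately show "cond_concat M V B A \<in> \<S>"
      by (simp add: regions_of_def)
  qed (rule sub)
  moreover have "cond_compl M X C \<in> \<S>" if "C \<in> \<S>" for C
  proof -
    from region[OF that] obtain S where S: "S \<in> regions_of M X \<S>" "C = cond_of M X S" by blast
    then have "X \<times> space M - S \<in> regions_of M X \<S>" by blast
    with S show ?thesis
      by (simp add: cond_compl_cond_of regions_of_def)
  qed
  moreover have "cond_Sup M X (range C) \<in> \<S>" if "range C \<subseteq> \<S>" for C :: "nat \<Rightarrow> _"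
  proof -
    have "\<forall>n. \<exists>S. S \<in> regions_of M X \<S> \<and> C n = cond_of M X S"
      using that region by blast
    from choice[OF this] obtain S where S: "\<And>n. S n \<in> regions_of M X \<S>" "\<And>n. C n = cond_of M X (S n)"
      by blast
    have "(\<Union>n. S n) \<in> regions_of M X \<S>"
      using S(1) by auto
    moreover have "cond_Sup M X (range C) = cond_of M X (\<Union>n. S n)"
      using cond_Sup_cond_of[of S] regions_ofD(1)[OF S(1)] by (simp add: S(2))
    ultimately show ?thesis
      by (simp add: regions_of_def)
  qed
  ultimately show ?thesis
    using top by (simp add: stable_sigma_algebra_def)
qed

lemma stable_sigma_algebra_imp_ring:
  assumes \<S>: "stable_sigma_algebra M X \<S>"
  shows "stable_ring M X \<S>"
proof -
  interpret R: sigma_algebra "X \<times> space M" "regions_of M X \<S>"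
    using \<S> by (rule stable_sigma_algebra_regions_of)
  have "cond_inf M X C (cond_compl M X D) \<in> \<S> \<and> cond_sup M X C D \<in> \<S>" if CD: "C \<in> \<S>" "D \<in> \<S>" for C D
  proof -
    have sub: "\<S> \<subseteq> cond_sets M X"
      using \<S> by (simp add: stable_sigma_algebra_def stable_collection_def)
    obtain S where S: "S \<in> regions M X" "C = cond_of M X S"
      using CD(1) sub by (meson cond_setsE_region subsetD)
    obtain T where T: "T \<in> regions M X" "D = cond_of M X T"
      using CD(2) sub by (meson cond_setsE_region subsetD)
    from S T have ST: "S \<in> regions_of M X \<S>" "T \<in> regions_of M X \<S>"
      using CD by (auto simp: regions_of_def)
    then have "S \<inter> (X \<times> space M - T) \<in> regions_of M X \<S>" "S \<union> T \<in> regions_of M X \<S>"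
      by blast+
    moreover have "X \<times> space M - T \<in> regions M X"
      using T(1) by auto
    ultimately show ?thesis
      using S T by (simp add: cond_compl_cond_of cond_inf_cond_of cond_sup_cond_of regions_of_def)
  qed
  then show ?thesis
    using \<S> by (auto simp: stable_ring_def stable_sigma_algebra_def)
qed

text \<open>
  Each closure property passes to intersections. Some stable \<open>\<sigma>\<close>-algebra \<open>\<S>\<close> above \<open>\<X>\<close> has to be given,
  as the intersection over an empty family would not consist of conditional sets.
\<close>

lemma stable_sigma_algebra_gen:
  assumes \<S>: "stable_sigma_algebra M X \<S>" "\<X> \<subseteq> \<S>"
  shows "stable_sigma_algebra M X (gen_stable_sigma_algebra M X \<X>)"
    and "gen_stable_sigma_algebra M X \<X> \<subseteq> \<S>"
    and "\<X> \<subseteq> gen_stable_sigma_algebra M X \<X>"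
proof -
  let ?G = "gen_stable_sigma_algebra M X \<X>"
  show sub: "?G \<subseteq> \<S>" and "\<X> \<subseteq> ?G"
    using \<S> by (auto simp: gen_stable_sigma_algebra_def)
  have G: "C \<in> ?G \<longleftrightarrow> (\<forall>\<T>. stable_sigma_algebra M X \<T> \<and> \<X> \<subseteq> \<T> \<longrightarrow> C \<in> \<T>)" for C
    by (auto simp: gen_stable_sigma_algebra_def)
  have top: "cond_top M X \<in> ?G"
    unfolding G by (auto simp: stable_sigma_algebra_def)
  have "stable_collection M X ?G"
    unfolding stable_collection_def
  proof (intro conjI allI impI)
    show "?G \<subseteq> cond_sets M X"
      using sub \<S>(1) by (auto simp: stable_sigma_algebra_def stable_collection_def)
    show "?G \<noteq> {}" using top by auto
    fix V :: "nat \<Rightarrow> _" and B A assume "\<forall>k. V k \<in> stable_subsets M X \<and> B k \<in> sets M \<and> restrict_set M (V k) (B k) \<in> ?G"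
      and "is_partition M A"
    then show "cond_concat M V B A \<in> ?G"
      unfolding G by (auto simp: stable_sigma_algebra_def stable_collection_def)
  qed
  moreover have "cond_compl M X C \<in> ?G" if "C \<in> ?G" for C
    using that unfolding G by (auto simp: stable_sigma_algebra_def)
  moreover have "cond_Sup M X (range C) \<in> ?G" if "range C \<subseteq> ?G" for C :: "nat \<Rightarrow> _"
    unfolding G
  proof (intro allI impI)
    fix \<T> assume \<T>: "stable_sigma_algebra M X \<T> \<and> \<X> \<subseteq> \<T>"
    with that have "range C \<subseteq> \<T>"
      using G by blast
    with \<T> show "cond_Sup M X (range C) \<in> \<T>"
      by (simp add: stable_sigma_algebra_def)
  qed
  ultimately show "stable_sigma_algebra M X ?G"
    using top by (simp add: stable_sigma_algebra_def)
qed

lemma stable_measure_restrict: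
  assumes \<nu>: "stable_measure M X \<S> \<nu>" and \<G>: "stable_sigma_algebra M X \<G>" and sub: "\<G> \<subseteq> \<S>"
  shows "stable_measure M X \<G> \<nu>"
proof -
  have \<nu>': "stable_premeasure M X \<S> \<nu>"
    using \<nu> by (simp add: stable_measure_def)
  have "stable_function M X \<G> \<nu>"
    unfolding stable_function_def
  proof (intro conjI ballI allI impI)
    show "stable_collection M X \<G>"
      using \<G> by (simp add: stable_sigma_algebra_def)
    show "\<nu> C \<in> borel_measurable M" if "C \<in> \<G>" for C
      using that \<nu>' sub by (auto simp: stable_premeasure_def stable_function_def)
    fix V :: "nat \<Rightarrow> _" and B A
    assume "\<forall>k. V k \<in> stable_subsets M X \<and> B k \<in> sets M \<and> restrict_set M (V k) (B k) \<in> \<G>"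
      and "is_partition M A"
    with sub show "AE \<omega> in M. \<nu> (cond_concat M V B A) \<omega> = concat_fun (\<lambda>k. \<nu> (restrict_set M (V k) (B k))) A \<omega>"
      by (intro \<nu>'[unfolded stable_premeasure_def stable_function_def, THEN conjunct2, THEN conjunct1,
            THEN conjunct2, THEN conjunct2, rule_format]) auto
  qed
  moreover have "AE \<omega> in M. \<nu> (restrict_set M V A) \<omega> = (if \<omega> \<in> A then \<nu> (restrict_set M V A) \<omega> else 0)"
    if "V \<in> stable_subsets M X" "A \<in> sets M" "restrict_set M V A \<in> \<G>" for V A
    using that sub by (intro \<nu>'[unfolded stable_premeasure_def, THEN conjunct2, THEN conjunct2, THEN conjunct1, rule_format]) auto
  moreover have "AE \<omega> in M. \<nu> (cond_Sup M X (range C)) \<omega> = (\<Sum>k. \<nu> (C k) \<omega>)"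
    if C: "range C \<subseteq> \<G>" "\<forall>i j. i \<noteq> j \<longrightarrow> cond_inf M X (C i) (C j) = cond_bot M X" "cond_Sup M X (range C) \<in> \<G>"
    for C :: "nat \<Rightarrow> ('w, 'e) cond_set"
    by (rule \<nu>'[unfolded stable_premeasure_def, THEN conjunct2, THEN conjunct2, THEN conjunct2, rule_format])
       (use C sub in auto)
  ultimately show ?thesis
    using \<G> stable_sigma_algebra_imp_ring[OF \<G>] by (simp add: stable_measure_def stable_premeasure_def)
qed

end

section \<open>Extending the mean mass of regions\<close>

text \<open>
  A set that cuts every element of the ring into two elements of the ring splits every cover additively,
  hence is Caratheodory-measurable although it may lie outside of the generated \<open>\<sigma>\<close>-algebra. The
  cylinders \<open>X \<times> A\<close> are of this kind: \<open>X\<close> itself need not be covered by countably many elements of \<open>\<X>\<close>.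
\<close>

lemma (in ring_of_sets) lambda_system_of_slices:
  assumes posf: "positive M f" and inc: "increasing M f" and add: "additive M f"
    and Z: "Z \<subseteq> \<Omega>" and slice: "\<And>a. a \<in> M \<Longrightarrow> a \<inter> Z \<in> M"
  shows "Z \<in> lambda_system \<Omega> (Pow \<Omega>) (outer_measure M f)"
proof -
  let ?O = "outer_measure M f"
  have sub: "subadditive (Pow \<Omega>) ?O"
    by (intro ring_of_sets.countably_subadditive_subadditive[OF ring_of_sets_Pow]
        positive_outer_measure posf countably_subadditive_outer_measure inc)
  have "?O (s \<inter> Z) + ?O (s - Z) = ?O s" if s: "s \<subseteq> \<Omega>" for s
  proof (rule antisym)
    show "?O s \<le> ?O (s \<inter> Z) + ?O (s - Z)"
      using subadditiveD[OF sub, of "s \<inter> Z" "s - Z"] s by (auto simp: Int_Diff_Un)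
    show "?O (s \<inter> Z) + ?O (s - Z) \<le> ?O s"
      unfolding outer_measure_def[of M f s]
    proof (rule INF_greatest)
      fix A :: "nat \<Rightarrow> _" assume "A \<in> {A. range A \<subseteq> M \<and> disjoint_family A \<and> s \<subseteq> (\<Union>i. A i)}"
      then have A: "\<And>i. A i \<in> M" "s \<subseteq> (\<Union>i. A i)" by auto
      have AZ: "A i \<inter> Z \<in> M" "A i - Z \<in> M" for i
      proof -
        show "A i \<inter> Z \<in> M" using A(1) by (rule slice)
        with A(1) have "A i - A i \<inter> Z \<in> M" by (rule Diff)
        moreover have "A i - A i \<inter> Z = A i - Z" by auto
        ultimately show "A i - Z \<in> M" by simp
      qed
      have "?O (s \<inter> Z) \<le> (\<Sum>i. f (A i \<inter> Z))"
        by (rule outer_measure_le[OF posf inc]) (use A(2) AZ(1) in auto)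
      moreover have "?O (s - Z) \<le> (\<Sum>i. f (A i - Z))"
        by (rule outer_measure_le[OF posf inc]) (use A(2) AZ(2) in auto)
      ultimately have "?O (s \<inter> Z) + ?O (s - Z) \<le> (\<Sum>i. f (A i \<inter> Z)) + (\<Sum>i. f (A i - Z))"
        by (rule add_mono)
      also have "\<dots> = (\<Sum>i. f (A i \<inter> Z) + f (A i - Z))"
        by (rule suminf_add) auto
      also have "\<dots> = (\<Sum>i. f (A i))"
      proof (rule suminf_cong)
        fix i
        have "f (A i \<inter> Z \<union> (A i - Z)) = f (A i \<inter> Z) + f (A i - Z)"
          by (rule additiveD[OF add _ AZ]) auto
        then show "f (A i \<inter> Z) + f (A i - Z) = f (A i)"
          by (simp add: Int_Diff_Un)
      qed
      finally show "?O (s \<inter> Z) + ?O (s - Z) \<le> (\<Sum>i. f (A i))" .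
    qed
  qed
  then show ?thesis
    using Z by (simp add: algebra.lambda_system_eq[OF algebra_Pow])
qed

locale stable_premeasure_base = stable_base M X for M :: "'w measure" and X :: "('w \<Rightarrow> 'e) set" +
  fixes \<X> and \<mu> :: "('w, 'e) cond_set \<Rightarrow> 'w \<Rightarrow> ennreal"
  assumes premeasure: "stable_premeasure M X \<X> \<mu>"
begin

abbreviation R :: "(('w \<Rightarrow> 'e) \<times> 'w) set set" where
  "R \<equiv> regions_of M X \<X>"

lemma \<X>_ring: "stable_ring M X \<X>" and \<mu>_stable: "stable_function M X \<X> \<mu>"
  using premeasure by (auto simp: stable_premeasure_def)

lemma \<X>_collection: "stable_collection M X \<X>"
  using \<X>_ring by (simp add: stable_ring_def)

sublocale R: ring_of_sets "X \<times> space M" R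
  using \<X>_ring by (rule ring_of_sets_regions_of)

lemma \<mu>_borel: "S \<in> R \<Longrightarrow> \<mu> (cond_of M X S) \<in> borel_measurable M"
  using \<mu>_stable by (simp add: stable_function_def regions_of_def)

text \<open>
  This is the law that the mass of \<open>V|A\<close> vanishes outside of \<open>A\<close>, for \<open>A = {}\<close>.
\<close>

lemma \<mu>_empty: "AE \<omega> in M. \<mu> (cond_of M X {}) \<omega> = 0"
proof -
  have "cond_of M X {} \<in> \<X>"
    using R.empty_sets by (rule regions_ofD)
  moreover have eq: "restrict_set M X {} = cond_of M X {}"
    using restrict_set_eq_cond_of_cylinder[of "{}"] by simp
  ultimately have "AE \<omega> in M. \<mu> (restrict_set M X {}) \<omega> = (if \<omega> \<in> {} then \<mu> (restrict_set M X {}) \<omega> else 0)"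
    by (intro premeasure[unfolded stable_premeasure_def, THEN conjunct2, THEN conjunct2, THEN conjunct1, rule_format]
        X_stable_subset sets.empty_sets) (simp only: eq)
  then show ?thesis
    unfolding eq by simp
qed

lemma
  assumes S: "S \<in> R" and A: "A \<in> sets M"
  shows R_cylinder: "S \<inter> X \<times> A \<in> R"
    and \<mu>_cylinder: "AE \<omega> in M. \<mu> (cond_of M X (S \<inter> X \<times> A)) \<omega> = \<mu> (cond_of M X S) \<omega> * indicator A \<omega>"
proof -
  \<comment> \<open>slicing by a cylinder is the concatenation of \<open>S\<close> on \<open>A\<close> with the empty region elsewhere\<close>
  define P where "P = (\<lambda>k::nat. if k = 0 then A else if k = 1 then space M - A else {})"
  define T where "T = (\<lambda>k::nat. if k = 0 then S else {})"
  have P: "is_partition M P"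
    unfolding P_def using A by (rule binary_partition)
  have T: "T k \<in> R" for k
    using S by (simp add: T_def)
  have eq: "(\<Union>k. T k \<inter> X \<times> P k) = S \<inter> X \<times> A"
    by (auto simp: T_def P_def split: if_splits)
  show "S \<inter> X \<times> A \<in> R"
    using regions_of_concat[of \<X> T P, OF \<X>_collection T P] by (simp add: eq)
  have P01: "P 0 = A" "P 1 = space M - A"
    by (simp_all add: P_def)
  have "AE \<omega> in M. \<mu> (cond_of M X (S \<inter> X \<times> A)) \<omega> = concat_fun (\<lambda>k. \<mu> (cond_of M X (T k))) P \<omega>"
    using stable_function_concat[of \<X> \<mu> T P, OF \<mu>_stable T P] by (simp only: eq)
  with \<mu>_empty AE_space
  show "AE \<omega> in M. \<mu> (cond_of M X (S \<inter> X \<times> A)) \<omega> = \<mu> (cond_of M X S) \<omega> * indicator A \<omega>"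
  proof eventually_elim
    case (elim \<omega>)
    then show ?case
      using concat_fun_eq[OF P, of \<omega> 0 "\<lambda>k. \<mu> (cond_of M X (T k))"]
        concat_fun_eq[OF P, of \<omega> 1 "\<lambda>k. \<mu> (cond_of M X (T k))"]
      by (cases "\<omega> \<in> A") (auto simp: P01 T_def simp del: One_nat_def)
  qed
qed

text \<open>
  The mean of \<open>\<mu>\<close>. Applied to slices by cylinders it still determines \<open>\<mu>\<close> almost surely, which is
  why passing to numbers loses nothing.
\<close>

definition mass :: "(('w \<Rightarrow> 'e) \<times> 'w) set \<Rightarrow> ennreal" where
  "mass S = (\<integral>\<^sup>+\<omega>. \<mu> (cond_of M X S) \<omega> \<partial>M)"

lemma mass_cylinder:
  assumes S: "S \<in> R" and A: "A \<in> sets M"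
  shows "mass (S \<inter> X \<times> A) = (\<integral>\<^sup>+\<omega>. \<mu> (cond_of M X S) \<omega> * indicator A \<omega> \<partial>M)"
  unfolding mass_def by (rule nn_integral_cong_AE) (rule \<mu>_cylinder[OF assms])

lemma mass_positive: "positive R mass"
  unfolding positive_def mass_def using nn_integral_cong_AE[OF \<mu>_empty] by simp

lemma mass_countably_additive: "countably_additive R mass"
  unfolding countably_additive_def
proof (intro allI impI)
  fix S :: "nat \<Rightarrow> _" assume S: "range S \<subseteq> R" "disjoint_family S" "(\<Union>n. S n) \<in> R"
  have SR: "S n \<in> R" for n
    using S(1) by auto
  note Sr = regions_ofD[OF SR]
  let ?C = "\<lambda>n. cond_of M X (S n)"
  have "cond_inf M X (?C i) (?C j) = cond_bot M X" if "i \<noteq> j" for i j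
  proof -
    have "S i \<inter> S j = {}"
      using S(2) that by (auto simp: disjoint_family_on_def)
    then show ?thesis
      using cond_inf_eq_bot_iff[OF Sr(1) Sr(1)] region_le_refl by simp
  qed
  moreover have Sup: "cond_Sup M X (range ?C) = cond_of M X (\<Union>n. S n)"
    using Sr(1) by (rule cond_Sup_cond_of)
  moreover have "range ?C \<subseteq> \<X>" "cond_of M X (\<Union>n. S n) \<in> \<X>"
    using Sr(2) regions_ofD(2)[OF S(3)] by auto
  ultimately have "AE \<omega> in M. \<mu> (cond_Sup M X (range ?C)) \<omega> = (\<Sum>n. \<mu> (?C n) \<omega>)"
    by (intro premeasure[unfolded stable_premeasure_def, THEN conjunct2, THEN conjunct2, THEN conjunct2, rule_format]) auto
  then have "mass (\<Union>n. S n) = (\<integral>\<^sup>+\<omega>. (\<Sum>n. \<mu> (?C n) \<omega>) \<partial>M)"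
    unfolding mass_def Sup by (rule nn_integral_cong_AE)
  also have "\<dots> = (\<Sum>n. mass (S n))"
    unfolding mass_def using \<mu>_borel[OF SR] by (rule nn_integral_suminf)
  finally show "(\<Sum>n. mass (S n)) = mass (\<Union>n. S n)" ..
qed

lemma mass_additive: "additive R mass"
  using mass_positive mass_countably_additive by (rule R.countably_additive_additive)

lemma mass_increasing: "increasing R mass"
  using mass_positive mass_additive by (rule R.additive_increasing)

text \<open>
  All Caratheodory-measurable sets are kept, and not only the \<open>\<sigma>\<close>-algebra generated by \<open>R\<close>, in order to
  have the cylinders among them.
\<close>

definition mass_measure :: "(('w \<Rightarrow> 'e) \<times> 'w) measure" where
  "mass_measure = measure_of (X \<times> space M) (lambda_system (X \<times> space M) (Pow (X \<times> space M)) (outer_measure R mass)) (outer_measure R mass)"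

lemma
  shows space_mass_measure: "space mass_measure = X \<times> space M"
    and sets_mass_measure: "sets mass_measure = lambda_system (X \<times> space M) (Pow (X \<times> space M)) (outer_measure R mass)"
    and emeasure_mass_measure: "S \<in> sets mass_measure \<Longrightarrow> emeasure mass_measure S = outer_measure R mass S"
proof -
  let ?L = "lambda_system (X \<times> space M) (Pow (X \<times> space M)) (outer_measure R mass)"
  have ms: "measure_space (X \<times> space M) ?L (outer_measure R mass)"
    by (rule sigma_algebra.caratheodory_lemma[OF sigma_algebra_Pow
          R.outer_measure_space_outer_measure[OF mass_positive mass_increasing]])
  interpret L: sigma_algebra "X \<times> space M" ?L
    using ms by (simp add: measure_space_def)
  show "space mass_measure = X \<times> space M"
    unfolding mass_measure_def by (rule space_measure_of[OF L.space_closed])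
  show sets: "sets mass_measure = ?L"
    unfolding mass_measure_def by (simp add: L.sets_measure_of_eq)
  show "emeasure mass_measure S = outer_measure R mass S" if "S \<in> sets mass_measure"
    by (rule emeasure_measure_of[OF mass_measure_def L.space_closed _ _ that])
       (use ms in \<open>simp_all add: sets measure_space_def\<close>)
qed

lemma slices_in_sets_mass_measure:
  assumes "Z \<subseteq> X \<times> space M" "\<And>S. S \<in> R \<Longrightarrow> S \<inter> Z \<in> R"
  shows "Z \<in> sets mass_measure"
  unfolding sets_mass_measure by (intro R.lambda_system_of_slices mass_positive mass_increasing mass_additive assms)

lemma R_subset_sets_mass_measure: "S \<in> R \<Longrightarrow> S \<in> sets mass_measure"
  by (intro slices_in_sets_mass_measure) (auto dest: R.sets_into_space)

lemma cylinder_in_sets_mass_measure: "A \<in> sets M \<Longrightarrow> X \<times> A \<in> sets mass_measure"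
  using sets.sets_into_space[of A M] by (intro slices_in_sets_mass_measure R_cylinder) auto

lemma emeasure_mass_measure_R: "S \<in> R \<Longrightarrow> emeasure mass_measure S = mass S"
  by (simp add: emeasure_mass_measure R_subset_sets_mass_measure R.outer_measure_agrees[OF mass_positive mass_countably_additive])

text \<open>
  A region with null sections represents the least conditional set, which lies in every stable ring.
  So the null ideal of the representation is contained in \<open>R\<close> and has mass zero.
\<close>

lemma
  assumes S: "S \<in> regions M X" and null: "region_le M X S {}"
  shows null_region_R: "S \<in> R" and emeasure_mass_measure_null_region: "emeasure mass_measure S = 0"
proof -
  have le: "region_le M X {} S"
    by (rule region_le_mono) simp
  show SR: "S \<in> R"
    by (rule regions_of_null_change[OF S R.empty_sets null le])
  have "cond_of M X S = cond_of M X {}"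
    using cond_of_eq_iff[OF S regions.empty_sets] null le by simp
  then show "emeasure mass_measure S = 0"
    using emeasure_mass_measure_R[OF SR] mass_positive by (simp add: mass_def positive_def)
qed

end

section \<open>The extension as a Radon--Nikodym density\<close>

context sigma_finite_measure
begin

text \<open>
  Uniqueness of densities also holds for functions with infinite integral, so equalities between values
  of \<open>\<nu>\<close> can always be checked under the integral.
\<close>

lemma AE_eq_if_nn_integral_indicator_eq:
  fixes g h :: "'a \<Rightarrow> ennreal"
  assumes g: "g \<in> borel_measurable M" and h: "h \<in> borel_measurable M"
    and eq: "\<And>A. A \<in> sets M \<Longrightarrow> (\<integral>\<^sup>+\<omega>. g \<omega> * indicator A \<omega> \<partial>M) = (\<integral>\<^sup>+\<omega>. h \<omega> * indicator A \<omega> \<partial>M)"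
  shows "AE \<omega> in M. g \<omega> = h \<omega>"
proof (rule density_unique[OF g h])
  show "density M g = density M h"
    by (rule measure_eqI) (use g h eq in \<open>simp_all add: emeasure_density\<close>)
qed

end

context stable_premeasure_base
begin

text \<open>
  The measurable regions, and below the conditional sets that they represent: the domain on which the
  extension is constructed.
\<close>

definition \<W> :: "(('w \<Rightarrow> 'e) \<times> 'w) set set" where
  "\<W> = sets mass_measure \<inter> regions M X"

definition \<S> :: "('w, 'e) cond_set set" where
  "\<S> = cond_of M X ` \<W>"

lemma \<W>D: "S \<in> \<W> \<Longrightarrow> S \<in> sets mass_measure" "S \<in> \<W> \<Longrightarrow> S \<in> regions M X"
  by (simp_all add: \<W>_def)

lemma sigma_algebra_\<W>: "sigma_algebra (X \<times> space M) \<W>"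
proof -
  interpret mass_measure: sigma_algebra "X \<times> space M" "sets mass_measure"
    using sets.sigma_algebra_axioms[of mass_measure] by (simp add: space_mass_measure)
  show ?thesis
    unfolding sigma_algebra_iff2 \<W>_def by (auto dest: regions_subset)
qed

sublocale \<W>: sigma_algebra "X \<times> space M" \<W>
  by (rule sigma_algebra_\<W>)

lemma R_subset_\<W>: "S \<in> R \<Longrightarrow> S \<in> \<W>"
  by (simp add: \<W>_def R_subset_sets_mass_measure regions_ofD)

lemma cylinder_in_\<W>: "A \<in> sets M \<Longrightarrow> X \<times> A \<in> \<W>"
  by (simp add: \<W>_def cylinder_in_sets_mass_measure cylinder_region)

text \<open>
  Measurability of a region depends only on the conditional set, since the difference of two representing
  regions has null sections.
\<close>

lemma \<W>_null_change:
  assumes T: "T \<in> \<W>" and S: "S \<in> regions M X" and eq: "cond_of M X S = cond_of M X T"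
  shows "S \<in> \<W>" and "S - T \<in> null_sets mass_measure" "T - S \<in> null_sets mass_measure"
proof -
  note Tr = \<W>D(2)[OF T]
  have le: "region_le M X S T" "region_le M X T S"
    using eq cond_of_eq_iff[OF S Tr] by auto
  have r: "S - T \<in> regions M X" "T - S \<in> regions M X"
    using S Tr by auto
  have ST: "S - T \<in> R" "T - S \<in> R" "emeasure mass_measure (S - T) = 0" "emeasure mass_measure (T - S) = 0"
    by (intro null_region_R emeasure_mass_measure_null_region r region_le_Diff le)+
  then show "S - T \<in> null_sets mass_measure" "T - S \<in> null_sets mass_measure"
    by (simp_all add: null_sets_def R_subset_sets_mass_measure)
  have "T - (T - S) \<union> (S - T) \<in> \<W>"
    using T ST(1,2)[THEN R_subset_\<W>] by blast
  moreover have "T - (T - S) \<union> (S - T) = S" by auto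
  ultimately show "S \<in> \<W>" by simp
qed

lemma emeasure_mass_measure_Int_cong:
  assumes T: "T \<in> \<W>" and S: "S \<in> \<W>" and eq: "cond_of M X S = cond_of M X T" and Z: "Z \<in> sets mass_measure"
  shows "emeasure mass_measure (S \<inter> Z) = emeasure mass_measure (T \<inter> Z)"
proof (rule emeasure_eq_AE)
  note null = \<W>_null_change(2,3)[OF T \<W>D(2)[OF S] eq]
  from AE_not_in[OF null(1)] AE_not_in[OF null(2)]
  show "AE z in mass_measure. z \<in> S \<inter> Z \<longleftrightarrow> z \<in> T \<inter> Z"
    by eventually_elim auto
qed (use \<W>D(1)[OF S] \<W>D(1)[OF T] Z in auto)

lemma regions_of_\<S>: "regions_of M X \<S> = \<W>"
proof
  show "\<W> \<subseteq> regions_of M X \<S>"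
    by (auto simp: regions_of_def \<S>_def \<W>_def)
  show "regions_of M X \<S> \<subseteq> \<W>"
  proof
    fix S assume "S \<in> regions_of M X \<S>"
    then obtain T where "T \<in> \<W>" "S \<in> regions M X" "cond_of M X S = cond_of M X T"
      by (auto simp: regions_of_def \<S>_def)
    then show "S \<in> \<W>"
      by (rule \<W>_null_change(1))
  qed
qed

lemma stable_sigma_algebra_\<S>: "stable_sigma_algebra M X \<S>"
proof (rule stable_sigma_algebraI)
  show "\<S> \<subseteq> cond_sets M X"
    by (auto simp: \<S>_def \<W>_def cond_of_in_cond_sets)
qed (simp_all add: regions_of_\<S> sigma_algebra_\<W> cylinder_in_\<W>)

lemma \<X>_subset_\<S>: "\<X> \<subseteq> \<S>"
proof
  fix C assume C: "C \<in> \<X>"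
  with \<X>_collection have "C \<in> cond_sets M X"
    by (auto simp: stable_collection_def)
  then obtain S where "S \<in> regions M X" "C = cond_of M X S"
    by (rule cond_setsE_region)
  with C have "S \<in> R" "C = cond_of M X S"
    by (simp_all add: regions_of_def)
  then show "C \<in> \<S>"
    using R_subset_\<W> by (auto simp: \<S>_def)
qed

text \<open>
  The mass of \<open>S \<inter> X \<times> A\<close>, as a function of \<open>A\<close>, is the image of the mass restricted to \<open>S\<close> under the projection to
  \<open>\<Omega>\<close>. It vanishes on null events because cylinders over them have null sections, so the Radon--Nikodym
  theorem applies.
\<close>

lemma ex_density:
  assumes S: "S \<in> \<W>"
  shows "\<exists>h\<in>borel_measurable M. \<forall>A\<in>sets M. (\<integral>\<^sup>+\<omega>. h \<omega> * indicator A \<omega> \<partial>M) = emeasure mass_measure (S \<inter> X \<times> A)"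
proof -
  note Sm = \<W>D(1)[OF S]
  define N where "N = distr (density mass_measure (indicator S)) M snd"
  have vim: "snd -` A \<inter> space mass_measure = X \<times> A" if "A \<in> sets M" for A
    using sets.sets_into_space[OF that] by (auto simp: space_mass_measure)
  have snd: "snd \<in> measurable mass_measure M"
  proof (rule measurableI)
    show "snd z \<in> space M" if "z \<in> space mass_measure" for z
      using that by (auto simp: space_mass_measure)
    show "snd -` A \<inter> space mass_measure \<in> sets mass_measure" if "A \<in> sets M" for A
      using that by (simp add: vim cylinder_in_sets_mass_measure)
  qed
  have N: "emeasure N A = emeasure mass_measure (S \<inter> X \<times> A)" if A: "A \<in> sets M" for A
  proof -
    have "emeasure N A = emeasure (density mass_measure (indicator S)) (X \<times> A)"
      unfolding N_def using snd A by (simp add: emeasure_distr vim)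
    also have "\<dots> = (\<integral>\<^sup>+z. indicator S z * indicator (X \<times> A) z \<partial>mass_measure)"
      using Sm cylinder_in_sets_mass_measure[OF A] by (simp add: emeasure_density)
    also have "\<dots> = (\<integral>\<^sup>+z. indicator (S \<inter> X \<times> A) z \<partial>mass_measure)"
      by (simp add: indicator_inter_arith)
    also have "\<dots> = emeasure mass_measure (S \<inter> X \<times> A)"
      using Sm cylinder_in_sets_mass_measure[OF A] by simp
    finally show ?thesis .
  qed
  have "absolutely_continuous M N"
    unfolding absolutely_continuous_def
  proof
    fix A assume A: "A \<in> null_sets M"
    then have Am: "A \<in> sets M" by auto
    have r: "S \<inter> X \<times> A \<in> regions M X"
      using \<W>D(2)[OF S] cylinder_region[OF Am] by auto
    have "region_le M X (S \<inter> X \<times> A) {}"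
      unfolding region_le_def
    proof
      fix x assume "x \<in> X"
      from AE_not_in[OF A] show "AE \<omega> in M. (x, \<omega>) \<in> S \<inter> X \<times> A \<longrightarrow> (x, \<omega>) \<in> {}"
        by eventually_elim auto
    qed
    from emeasure_mass_measure_null_region[OF r this] show "A \<in> null_sets N"
      using Am by (simp add: null_sets_def N) (simp add: N_def)
  qed
  moreover have "sets N = sets M"
    by (simp add: N_def)
  ultimately obtain h where h: "h \<in> borel_measurable M" "density M h = N"
    using Radon_Nikodym by blast
  have "(\<integral>\<^sup>+\<omega>. h \<omega> * indicator A \<omega> \<partial>M) = emeasure mass_measure (S \<inter> X \<times> A)" if A: "A \<in> sets M" for A
    using emeasure_density[OF h(1) A] N[OF A] by (simp add: h(2))
  with h(1) show ?thesis by blast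
qed

text \<open>
  Quantifying over all representing regions makes \<open>\<nu>\<close> a function of the conditional set.
\<close>

definition is_density :: "('w, 'e) cond_set \<Rightarrow> ('w \<Rightarrow> ennreal) \<Rightarrow> bool" where
  "is_density C h \<longleftrightarrow> h \<in> borel_measurable M \<and> (\<forall>S\<in>\<W>. cond_of M X S = C \<longrightarrow>
     (\<forall>A\<in>sets M. (\<integral>\<^sup>+\<omega>. h \<omega> * indicator A \<omega> \<partial>M) = emeasure mass_measure (S \<inter> X \<times> A)))"

definition \<nu> :: "('w, 'e) cond_set \<Rightarrow> 'w \<Rightarrow> ennreal" where
  "\<nu> C = (SOME h. is_density C h)"

lemma
  assumes S: "S \<in> \<W>"
  shows \<nu>_borel: "\<nu> (cond_of M X S) \<in> borel_measurable M"
    and nn_integral_\<nu>: "A \<in> sets M \<Longrightarrow>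
      (\<integral>\<^sup>+\<omega>. \<nu> (cond_of M X S) \<omega> * indicator A \<omega> \<partial>M) = emeasure mass_measure (S \<inter> X \<times> A)"
proof -
  obtain h where h: "h \<in> borel_measurable M"
    "\<And>A. A \<in> sets M \<Longrightarrow> (\<integral>\<^sup>+\<omega>. h \<omega> * indicator A \<omega> \<partial>M) = emeasure mass_measure (S \<inter> X \<times> A)"
    using ex_density[OF S] by blast
  have "is_density (cond_of M X S) h"
    unfolding is_density_def
  proof (intro conjI ballI impI)
    fix T A assume T: "T \<in> \<W>" "cond_of M X T = cond_of M X S" and A: "A \<in> sets M"
    show "(\<integral>\<^sup>+\<omega>. h \<omega> * indicator A \<omega> \<partial>M) = emeasure mass_measure (T \<inter> X \<times> A)"
      unfolding h(2)[OF A] by (rule emeasure_mass_measure_Int_cong[OF S T cylinder_in_sets_mass_measure[OF A], symmetric])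
  qed (rule h(1))
  then have "is_density (cond_of M X S) (\<nu> (cond_of M X S))"
    unfolding \<nu>_def by (rule someI[where P = "is_density (cond_of M X S)"])
  then show "\<nu> (cond_of M X S) \<in> borel_measurable M"
    "A \<in> sets M \<Longrightarrow> (\<integral>\<^sup>+\<omega>. \<nu> (cond_of M X S) \<omega> * indicator A \<omega> \<partial>M) = emeasure mass_measure (S \<inter> X \<times> A)"
    using S unfolding is_density_def by blast+
qed

lemma \<nu>_extends_\<mu>:
  assumes S: "S \<in> R" shows "AE \<omega> in M. \<nu> (cond_of M X S) \<omega> = \<mu> (cond_of M X S) \<omega>"
proof (rule AE_eq_if_nn_integral_indicator_eq)
  show "\<nu> (cond_of M X S) \<in> borel_measurable M" "\<mu> (cond_of M X S) \<in> borel_measurable M"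
    using S by (auto intro: \<nu>_borel R_subset_\<W> \<mu>_borel)
  fix A assume A: "A \<in> sets M"
  show "(\<integral>\<^sup>+\<omega>. \<nu> (cond_of M X S) \<omega> * indicator A \<omega> \<partial>M) = (\<integral>\<^sup>+\<omega>. \<mu> (cond_of M X S) \<omega> * indicator A \<omega> \<partial>M)"
    unfolding nn_integral_\<nu>[OF R_subset_\<W>[OF S] A] emeasure_mass_measure_R[OF R_cylinder[OF S A]]
    by (rule mass_cylinder[OF S A])
qed

text \<open>
  The value of \<open>\<nu>\<close> on an event depends only on the slice of the region over that event. This is the
  locality behind the stability of \<open>\<nu>\<close>.
\<close>

lemma \<nu>_local:
  assumes S: "S \<in> \<W>" and T: "T \<in> \<W>" and A: "A \<in> sets M" and eq: "S \<inter> X \<times> A = T \<inter> X \<times> A"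
  shows "AE \<omega> in M. \<omega> \<in> A \<longrightarrow> \<nu> (cond_of M X S) \<omega> = \<nu> (cond_of M X T) \<omega>"
proof -
  have "AE \<omega> in M. \<nu> (cond_of M X S) \<omega> * indicator A \<omega> = \<nu> (cond_of M X T) \<omega> * indicator A \<omega>"
  proof (rule AE_eq_if_nn_integral_indicator_eq)
    fix B assume B: "B \<in> sets M"
    have AB: "A \<inter> B \<in> sets M" using A B by auto
    have "S \<inter> X \<times> (A \<inter> B) = T \<inter> X \<times> (A \<inter> B)" using eq by auto
    then show "(\<integral>\<^sup>+\<omega>. \<nu> (cond_of M X S) \<omega> * indicator A \<omega> * indicator B \<omega> \<partial>M) =
        (\<integral>\<^sup>+\<omega>. \<nu> (cond_of M X T) \<omega> * indicator A \<omega> * indicator B \<omega> \<partial>M)"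
      using nn_integral_\<nu>[OF S AB] nn_integral_\<nu>[OF T AB]
      by (simp add: indicator_inter_arith mult.assoc)
  qed (use A \<nu>_borel[OF S] \<nu>_borel[OF T] in auto)
  then show ?thesis
    by eventually_elim auto
qed

lemma \<S>E:
  assumes "C \<in> \<S>" obtains S where "S \<in> \<W>" "C = cond_of M X S"
  using assms by (auto simp: \<S>_def)

lemma \<nu>_stable: "stable_function M X \<S> \<nu>"
  unfolding stable_function_def
proof (intro conjI ballI allI impI)
  show "stable_collection M X \<S>"
    using stable_sigma_algebra_\<S> by (simp add: stable_sigma_algebra_def)
  show "\<nu> C \<in> borel_measurable M" if "C \<in> \<S>" for C
    using that by (elim \<S>E) (simp add: \<nu>_borel)
  fix V :: "nat \<Rightarrow> _" and B A
  assume VB: "\<forall>k. V k \<in> stable_subsets M X \<and> B k \<in> sets M \<and> restrict_set M (V k) (B k) \<in> \<S>"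
    and A: "is_partition M A"
  then have "\<forall>k. \<exists>S. S \<in> \<W> \<and> restrict_set M (V k) (B k) = cond_of M X S"
    by (auto simp: \<S>_def)
  from choice[OF this] obtain S where S: "\<And>k. S k \<in> \<W>" "\<And>k. restrict_set M (V k) (B k) = cond_of M X (S k)"
    by blast
  let ?U = "\<Union>k. S k \<inter> X \<times> A k"
  have eq: "cond_concat M V B A = cond_of M X ?U"
    using VB S A by (intro cond_concat_eq) (auto simp: \<W>_def)
  have U: "?U \<in> \<W>"
    using S(1) cylinder_in_\<W>[OF partition_sets[OF A]] by auto
  show "AE \<omega> in M. \<nu> (cond_concat M V B A) \<omega> = concat_fun (\<lambda>k. \<nu> (restrict_set M (V k) (B k))) A \<omega>"
    unfolding eq S(2)
  proof (rule AE_partitionI[OF A])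
    fix k
    have "?U \<inter> X \<times> A k = S k \<inter> X \<times> A k"
      using partition_unique[OF A] by blast
    from \<nu>_local[OF U S(1) partition_sets[OF A] this]
    show "AE \<omega> in M. \<omega> \<in> A k \<longrightarrow> \<nu> (cond_of M X ?U) \<omega> = concat_fun (\<lambda>k. \<nu> (cond_of M X (S k))) A \<omega>"
      by eventually_elim (simp add: concat_fun_eq[OF A])
  qed
qed

text \<open>
  The region of \<open>V|A\<close> has null sections over the complement of \<open>A\<close>, hence carries no mass there.
\<close>

lemma \<nu>_support:
  assumes V: "V \<in> stable_subsets M X" and A: "A \<in> sets M" and VA: "restrict_set M V A \<in> \<S>"
  shows "AE \<omega> in M. \<nu> (restrict_set M V A) \<omega> = (if \<omega> \<in> A then \<nu> (restrict_set M V A) \<omega> else 0)"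
proof -
  obtain S where S: "S \<in> \<W>" "restrict_set M V A = cond_of M X S"
    using VA \<S>E by blast
  have Ac: "space M - A \<in> sets M"
    using A by auto
  have "region_le M X (S \<inter> X \<times> (space M - A)) {}"
    unfolding region_le_def
  proof
    fix x assume x: "x \<in> X"
    let ?B = "{\<omega> \<in> space M. (x, \<omega>) \<in> S}"
    have B: "?B \<in> sets M"
      using \<W>D(2)[OF S(1)] x by (rule regions_section)
    have "AE \<omega> in M. \<omega> \<in> ?B \<longrightarrow> (x, \<omega>) \<in> S" by auto
    then have "locally_in M (restrict_set M V A) x ?B"
      using represents_cond_of[OF \<W>D(2)[OF S(1)]] x B unfolding S(2) represents_def by blast
    then obtain v where "AE \<omega> in M. \<omega> \<in> ?B \<longrightarrow> \<omega> \<in> A \<and> x \<omega> = v \<omega>"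
      unfolding locally_in_restrict_set[OF A] by blast
    then show "AE \<omega> in M. (x, \<omega>) \<in> S \<inter> X \<times> (space M - A) \<longrightarrow> (x, \<omega>) \<in> {}"
      by eventually_elim auto
  qed
  moreover have "S \<inter> X \<times> (space M - A) \<in> regions M X"
    using \<W>D(2)[OF S(1)] cylinder_region[OF Ac] by auto
  ultimately have "emeasure mass_measure (S \<inter> X \<times> (space M - A)) = 0"
    by (intro emeasure_mass_measure_null_region)
  then have "(\<integral>\<^sup>+\<omega>. \<nu> (cond_of M X S) \<omega> * indicator (space M - A) \<omega> \<partial>M) = 0"
    using nn_integral_\<nu>[OF S(1) Ac] by simp
  then have "AE \<omega> in M. \<nu> (cond_of M X S) \<omega> * indicator (space M - A) \<omega> = 0"
    using \<nu>_borel[OF S(1)] Ac by (subst (asm) nn_integral_0_iff_AE) auto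
  with AE_space show ?thesis
    unfolding S(2) by eventually_elim (auto split: split_indicator_asm)
qed

text \<open>
  Conditional disjointness means that the regions intersect in null sections only. Replacing them by
  their disjointed sequence does not change the conditional sets, and then the additivity of the mass on
  every cylinder is the claim under the integral.
\<close>

lemma \<nu>_additive:
  assumes C: "range C \<subseteq> \<S>" and disj: "\<And>i j::nat. i \<noteq> j \<Longrightarrow> cond_inf M X (C i) (C j) = cond_bot M X"
  shows "AE \<omega> in M. \<nu> (cond_Sup M X (range C)) \<omega> = (\<Sum>n. \<nu> (C n) \<omega>)"
proof -
  have "\<forall>n. \<exists>S. S \<in> \<W> \<and> C n = cond_of M X S"
  proof
    fix n
    have "C n \<in> \<S>" using C by auto
    then show "\<exists>S. S \<in> \<W> \<and> C n = cond_of M X S" unfolding \<S>_def by blast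
  qed
  from choice[OF this] obtain S where S: "\<And>n. S n \<in> \<W>" "\<And>n. C n = cond_of M X (S n)"
    by blast
  define T where "T = disjointed S"
  have T: "T n \<in> \<W>" for n
    using \<W>.range_disjointed_sets[of S] S(1) by (auto simp: T_def)
  have UT: "(\<Union>n. T n) = (\<Union>n. S n)"
    by (simp add: T_def UN_disjointed_eq)
  have "region_le M X (S n) (T n)" for n
    unfolding region_le_def
  proof
    fix x assume x: "x \<in> X"
    have "AE \<omega> in M. i \<noteq> n \<longrightarrow> (x, \<omega>) \<in> S i \<inter> S n \<longrightarrow> (x, \<omega>) \<in> {}" for i
    proof (cases "i = n")
      case False
      from disj[OF False] have "region_le M X (S i \<inter> S n) {}"
        using cond_inf_eq_bot_iff[OF \<W>D(2)[OF S(1)[of i]] \<W>D(2)[OF S(1)[of n]]] by (simp add: S(2))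
      with x show ?thesis
        by (simp add: region_le_def)
    qed simp
    then have "AE \<omega> in M. \<forall>i. i \<noteq> n \<longrightarrow> (x, \<omega>) \<in> S i \<inter> S n \<longrightarrow> (x, \<omega>) \<in> {}"
      unfolding AE_all_countable by blast
    then show "AE \<omega> in M. (x, \<omega>) \<in> S n \<longrightarrow> (x, \<omega>) \<in> T n"
      by eventually_elim (auto simp: T_def disjointed_def)
  qed
  moreover have "region_le M X (T n) (S n)" for n
    unfolding T_def by (rule region_le_mono[OF disjointed_subset])
  ultimately have CT: "C n = cond_of M X (T n)" for n
    unfolding S(2) using cond_of_eq_iff[OF \<W>D(2)[OF S(1)] \<W>D(2)[OF T]] by blast
  have Sup: "cond_Sup M X (range C) = cond_of M X (\<Union>n. T n)"
    unfolding CT[abs_def] by (rule cond_Sup_cond_of[OF \<W>D(2)[OF T]])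
  have U: "(\<Union>n. T n) \<in> \<W>"
    using T by auto
  show ?thesis
    unfolding Sup CT
  proof (rule AE_eq_if_nn_integral_indicator_eq)
    fix A assume A: "A \<in> sets M"
    have "disjoint_family T"
      by (simp add: T_def disjoint_family_disjointed)
    then have "(\<Sum>n. emeasure mass_measure (T n \<inter> X \<times> A)) = emeasure mass_measure (\<Union>n. T n \<inter> X \<times> A)"
      using \<W>D(1)[OF T] cylinder_in_sets_mass_measure[OF A]
      by (intro suminf_emeasure) (auto simp: disjoint_family_on_def)
    also have "(\<Union>n. T n \<inter> X \<times> A) = (\<Union>n. T n) \<inter> X \<times> A"
      by auto
    finally have "(\<integral>\<^sup>+\<omega>. \<nu> (cond_of M X (\<Union>n. T n)) \<omega> * indicator A \<omega> \<partial>M) =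
        (\<Sum>n. \<integral>\<^sup>+\<omega>. \<nu> (cond_of M X (T n)) \<omega> * indicator A \<omega> \<partial>M)"
      by (simp add: nn_integral_\<nu>[OF U A] nn_integral_\<nu>[OF T A])
    also have "\<dots> = (\<integral>\<^sup>+\<omega>. (\<Sum>n. \<nu> (cond_of M X (T n)) \<omega> * indicator A \<omega>) \<partial>M)"
      using \<nu>_borel[OF T] A by (intro nn_integral_suminf[symmetric]) auto
    finally show "(\<integral>\<^sup>+\<omega>. \<nu> (cond_of M X (\<Union>n. T n)) \<omega> * indicator A \<omega> \<partial>M) =
        (\<integral>\<^sup>+\<omega>. (\<Sum>n. \<nu> (cond_of M X (T n)) \<omega>) * indicator A \<omega> \<partial>M)"
      by simp
  qed (use \<nu>_borel[OF U] \<nu>_borel[OF T] in auto)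
qed

lemma stable_measure_\<nu>: "stable_measure M X \<S> \<nu>"
  unfolding stable_measure_def stable_premeasure_def
  using stable_sigma_algebra_\<S> stable_sigma_algebra_imp_ring[OF stable_sigma_algebra_\<S>]
    \<nu>_stable \<nu>_support \<nu>_additive
  by simp

end

theorem theorem3p12:
  fixes M :: "'w measure" and X :: "('w \<Rightarrow> 'e) set"
    and \<X> :: "('w, 'e) cond_set set"
    and \<mu> :: "('w, 'e) cond_set \<Rightarrow> 'w \<Rightarrow> ennreal"
  assumes "prob_space M" and "complete_measure M"
    and "stable_set M X"
    and "stable_ring M X \<X>"
    and "stable_premeasure M X \<X> \<mu>"
  shows "\<exists>\<nu>. stable_measure M X (gen_stable_sigma_algebra M X \<X>) \<nu> \<and>
    (\<forall>C\<in>\<X>. AE \<omega> in M. \<nu> C \<omega> = \<mu> C \<omega>)"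
proof -
  interpret prob_space M by fact
  interpret P: stable_premeasure_base M X \<X> \<mu>
    by unfold_locales fact+
  note gen = P.stable_sigma_algebra_gen[OF P.stable_sigma_algebra_\<S> P.\<X>_subset_\<S>]
  have "stable_measure M X (gen_stable_sigma_algebra M X \<X>) P.\<nu>"
    by (rule P.stable_measure_restrict[OF P.stable_measure_\<nu> gen(1,2)])
  moreover have "AE \<omega> in M. P.\<nu> C \<omega> = \<mu> C \<omega>" if C: "C \<in> \<X>" for C
  proof -
    have "C \<in> cond_sets M X"
      using C P.\<X>_collection by (auto simp: stable_collection_def)
    then obtain S where S: "S \<in> regions M X" "C = cond_of M X S"
      by (rule P.cond_setsE_region)
    with C have "S \<in> regions_of M X \<X>"
      by (simp add: regions_of_def)
    from P.\<nu>_extends_\<mu>[OF this] show ?thesis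
      by (simp add: S(2))
  qed
  ultimately show ?thesis
    by blast
qed

end
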